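(* Let $G$ be a finite undirected unweighted graph and $e=\{u,v\}$ an edge with $\deg_G(u)=\deg_G(v)$. Let $L=\mathsf{Nbr}_G(u)\setminus(\mathsf{Nbr}_G(v)\cup\{v\})$, $R=\mathsf{Nbr}_G(v)\setminus(\mathsf{Nbr}_G(u)\cup\{u\})$, and let $H=(L,R,w)$ be the complete bipartite graph with $w(x,y)=\mathrm{dist}_G(x,y)\in\{1,2,3\}$. Let $d,\varepsilon>0$ be fixed constants. Then, using $O(1)$ expected weighted neighbor queries on $H$ (the constant depending on $d$ and $\varepsilon$), given the neighbor lists of $u$ and $v$, one can obtain: (a) an additive $(1+\varepsilon)$-approximation of $\mathfrak{C}_G(e)$ when $\max_x \deg_{H,1}(x)\le d$; and (b) an additive $(\tfrac12+\varepsilon)$-approximation of $\mathfrak{C}_G(e)$ when $\max_x\deg_{H,1}(x)\le d$ and $\max_x\deg_{H,2}(x)\le d$.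
   Context: $\mathsf{Nbr}_G(x)$ is the neighbor set, $\deg_G(x)=|\mathsf{Nbr}_G(x)|$, $\mathrm{dist}_G$ the shortest-path distance. For $j\in\{1,2\}$, $\deg_{H,j}(x)$ is the number of edges of weight $j$ incident on node $x$ in $H$. The Ollivier–Ricci curvature of $e=\{u,v\}$ is $\mathfrak{C}_G(e)=1-\mathrm{EMD}$, where $\mathrm{EMD}$ is the optimal value of the linear program with variables $z_{x,y}\ge0$ for $x\in\{u\}\cup\mathsf{Nbr}_G(u)$, $y\in\{v\}\cup\mathsf{Nbr}_G(v)$, minimizing $\sum_{x,y}\mathrm{dist}_G(x,y)z_{x,y}$ subject to $\sum_y z_{x,y}=1/(1+\deg_G(u))$ for every $x$ and $\sum_x z_{x,y}=1/(1+\deg_G(v))$ for every $y$. A weighted neighbor query $(x,s)$ on $H$ returns a uniformly random not-yet-explored node $z$ with $w(x,z)=s$, or a special symbol if none exists. An additive $\rho$-approximation of a quantity $X$ is a value $\beta$ with $X\le\beta\le X+\rho$.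
   Formalization: The approximation is obtained with probability at least 1−δ for any fixed δ in (0,1), the constant depending also on δ; obtaining it with certainty from O(1) expected queries is impossible (no weight-1 edges versus a weight-1 matching missing the explored nodes). *)

theory Defs
  imports "HOL-Probability.Probability" "Graph_Theory.Graph_Theory"
begin

section \<open>Ollivier--Ricci curvature of an edge\<close>

text \<open>Finite simple undirected graphs are rendered by the locale \<^locale>\<open>pair_graph\<close>:
  a finite vertex set together with a symmetric irreflexive set of pairs.\<close>

definition nbrs :: "'a pair_pre_digraph \<Rightarrow> 'a \<Rightarrow> 'a set" where
  "nbrs G x = {y. x \<rightarrow>\<^bsub>with_proj G\<^esub> y}"

abbreviation deg :: "'a pair_pre_digraph \<Rightarrow> 'a \<Rightarrow> nat" where
  "deg G x \<equiv> card (nbrs G x)"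

text \<open>The distance is unspecified for disconnected pairs; below it is only applied to pairs of
  vertices that lie within distance 1 of a common edge.\<close>

definition gdist :: "'a pair_pre_digraph \<Rightarrow> 'a \<Rightarrow> 'a \<Rightarrow> nat" where
  "gdist G x y = (LEAST n. \<exists>p. pre_digraph.awalk (with_proj G) x p y \<and> length p = n)"

definition transport_plans :: "'a pair_pre_digraph \<Rightarrow> 'a \<Rightarrow> 'a \<Rightarrow> ('a \<Rightarrow> 'a \<Rightarrow> real) set" where
  "transport_plans G u v =
    {z. (\<forall>x \<in> {u} \<union> nbrs G u. \<forall>y \<in> {v} \<union> nbrs G v. 0 \<le> z x y) \<and>
        (\<forall>x \<in> {u} \<union> nbrs G u. (\<Sum>y \<in> {v} \<union> nbrs G v. z x y) = 1 / (1 + real (deg G u))) \<and>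
        (\<forall>y \<in> {v} \<union> nbrs G v. (\<Sum>x \<in> {u} \<union> nbrs G u. z x y) = 1 / (1 + real (deg G v)))}"

definition emd :: "'a pair_pre_digraph \<Rightarrow> 'a \<Rightarrow> 'a \<Rightarrow> real" where
  "emd G u v = (INF z \<in> transport_plans G u v.
     \<Sum>x \<in> {u} \<union> nbrs G u. \<Sum>y \<in> {v} \<union> nbrs G v. real (gdist G x y) * z x y)"

definition curvature :: "'a pair_pre_digraph \<Rightarrow> 'a \<Rightarrow> 'a \<Rightarrow> real" where
  "curvature G u v = 1 - emd G u v"

definition additive_approx :: "real \<Rightarrow> real \<Rightarrow> real \<Rightarrow> bool" where
  "additive_approx \<rho> X \<beta> \<longleftrightarrow> X \<le> \<beta> \<and> \<beta> \<le> X + \<rho>"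


section \<open>Weighted complete bipartite graphs\<close>

record 'a wbip =
  left_part :: "'a set"
  right_part :: "'a set"
  edge_weight :: "'a \<Rightarrow> 'a \<Rightarrow> nat"  \<comment> \<open>relevant only on \<open>left_part \<times> right_part\<close>\<close>

definition wnbrs :: "'a wbip \<Rightarrow> 'a \<Rightarrow> nat \<Rightarrow> 'a set" where
  "wnbrs H x s =
    {z. (x \<in> left_part H \<and> z \<in> right_part H \<and> edge_weight H x z = s) \<or>
        (x \<in> right_part H \<and> z \<in> left_part H \<and> edge_weight H z x = s)}"

text \<open>The two parts are disjoint wherever this is used, so the edges of weight \<open>j\<close> at \<open>x\<close>
  correspond to their other endpoints.\<close>

definition wdeg :: "'a wbip \<Rightarrow> nat \<Rightarrow> 'a \<Rightarrow> nat" where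
  "wdeg H j x = card (wnbrs H x j)"

definition max_wdeg_le :: "'a wbip \<Rightarrow> nat \<Rightarrow> real \<Rightarrow> bool" where
  "max_wdeg_le H j d \<longleftrightarrow> (\<forall>x \<in> left_part H \<union> right_part H. real (wdeg H j x) \<le> d)"

definition edge_bip :: "'a pair_pre_digraph \<Rightarrow> 'a \<Rightarrow> 'a \<Rightarrow> 'a wbip" where
  "edge_bip G u v =
    \<lparr> left_part = nbrs G u - (nbrs G v \<union> {v}),
      right_part = nbrs G v - (nbrs G u \<union> {u}),
      edge_weight = gdist G \<rparr>"


section \<open>Randomized algorithms with weighted neighbor queries\<close>

text \<open>An algorithm is a randomized decision tree: it outputs a number, makes an internal random
  choice, or asks a weighted neighbor query \<open>(x, s)\<close> and continues depending on the answer,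
  where \<open>None\<close> is the special symbol. Trees are well-founded, so every run halts, but their depth
  may be unbounded. Only queries are charged for.\<close>

datatype 'a query_alg =
    Output real
  | Choose "'a query_alg pmf"
  | Query 'a nat "'a option \<Rightarrow> 'a query_alg"

text \<open>\<open>X x\<close> is the set of nodes already explored from \<open>x\<close>, i.e. returned by earlier queries
  at \<open>x\<close>. Repeating \<open>(x, s)\<close> thus lists the neighbors of \<open>x\<close> along edges of weight \<open>s\<close> in
  uniformly random order without repetition and then yields \<open>None\<close>.\<close>

definition answer :: "'a wbip \<Rightarrow> ('a \<Rightarrow> 'a set) \<Rightarrow> 'a \<Rightarrow> nat \<Rightarrow> 'a option pmf" where
  "answer H X x s =
    (if wnbrs H x s - X x = {} then return_pmf None
     else map_pmf Some (pmf_of_set (wnbrs H x s - X x)))"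

definition explore :: "('a \<Rightarrow> 'a set) \<Rightarrow> 'a \<Rightarrow> 'a option \<Rightarrow> 'a \<Rightarrow> 'a set" where
  "explore X x a = X(x := X x \<union> set_option a)"

text \<open>Joint distribution of the output and the number of queries asked; every query counts,
  including those answered by \<open>None\<close>.\<close>

primrec run_from :: "'a wbip \<Rightarrow> 'a query_alg \<Rightarrow> ('a \<Rightarrow> 'a set) \<Rightarrow> (real \<times> nat) pmf" where
  "run_from H (Output r) = (\<lambda>X. return_pmf (r, 0))"
| "run_from H (Choose p) = (\<lambda>X. bind_pmf (map_pmf (run_from H) p) (\<lambda>f. f X))"
| "run_from H (Query x s k) = (\<lambda>X. bind_pmf (answer H X x s)
     (\<lambda>a. map_pmf (apsnd Suc) (run_from H (k a) (explore X x a))))"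

definition run :: "'a wbip \<Rightarrow> 'a query_alg \<Rightarrow> (real \<times> nat) pmf" where
  "run H t = run_from H t (\<lambda>_. {})"

text \<open>The algorithm learns about \<open>G\<close> only the endpoints \<open>u\<close>, \<open>v\<close> and their neighbor lists
  (in arbitrary order), and the answers to its queries on \<open>edge_bip G u v\<close>. The expected number of
  queries is a nonnegative integral, so the bound includes integrability.\<close>

definition estimates_curvature ::
  "('a \<Rightarrow> 'a \<Rightarrow> 'a list \<Rightarrow> 'a list \<Rightarrow> 'a query_alg) \<Rightarrow> ('a wbip \<Rightarrow> bool)
    \<Rightarrow> real \<Rightarrow> real \<Rightarrow> real \<Rightarrow> bool" where
  "estimates_curvature A P \<rho> \<delta> C \<longleftrightarrow>
    (\<forall>G u v us vs.
      pair_graph G \<and> (u, v) \<in> parcs G \<and> deg G u = deg G v \<and>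
      distinct us \<and> set us = nbrs G u \<and> distinct vs \<and> set vs = nbrs G v \<and>
      P (edge_bip G u v) \<longrightarrow>
        measure_pmf.prob (run (edge_bip G u v) (A u v us vs))
          {(\<beta>, q). additive_approx \<rho> (curvature G u v) \<beta>} \<ge> 1 - \<delta> \<and>
        (\<integral>\<^sup>+ (\<beta>, q). ennreal (real q) \<partial>measure_pmf (run (edge_bip G u v) (A u v us vs)))
          \<le> ennreal C)"

end

theory Submission
  imports Defs
begin

text \<open>Let \<open>m = |L| = |R|\<close> and let \<open>n\<close> be the common degree. Assign to a pair \<open>(x, y)\<close> the gain 2 at
  distance 1, the gain 1 at distance 2 (only in case (b)), and 0 otherwise. Distances are at most 3, so
  a matching of total gain \<open>S\<close> extends to a transport plan of cost at most \<open>(3 m - S) / (n + 1)\<close>;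
  conversely, dual prices and profits of total value \<open>V\<close> show that every plan costs at least
  \<open>(\<kappa> m - V) / (n + 1)\<close>, where \<open>\<kappa> = 3\<close> in case (b), while \<open>\<kappa> = 2\<close> in case (a) since the distance 2
  carries no gain there.

  Nearly optimal \<open>S\<close> and \<open>V\<close> come from Bertsekas' auction with increment \<open>\<eta>\<close>: nodes of \<open>L\<close> bid for
  nodes of \<open>R\<close>. At every time \<open>V \<le> S + \<eta> m + 2 U\<close>, where \<open>U\<close> counts the nodes still bidding. Each
  bid raises a bounded price, so for bounded degree \<open>U\<close> is at most a small fraction of \<open>m\<close> on average
  over constantly many rounds. The state of a node after \<open>t\<close> rounds depends only on its ball of radius
  \<open>2 t\<close> in the graph of positive gains, which constantly many queries explore. Sampling nodes of \<open>R\<close>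
  and averaging the gains they receive therefore estimates \<open>S\<close>, by Hoeffding's inequality. The
  argument bounds the number of queries in the worst case and gives the error \<open>\<epsilon>\<close> in case (b).\<close>

section \<open>A local auction\<close>

text \<open>Ownership is tested only at neighbours of \<open>x\<close>, which keeps the condition
  local; by \<open>owner_adj\<close> a node owns nothing elsewhere.\<close>

definition auction_bids :: "('a \<Rightarrow> 'a \<Rightarrow> real) \<Rightarrow> ('a \<Rightarrow> 'a option \<times> real) \<Rightarrow> 'a \<Rightarrow> bool" where
  "auction_bids g s x \<longleftrightarrow>
    (\<forall>y. 0 < g x y \<longrightarrow> fst (s y) \<noteq> Some x) \<and> (\<exists>y. 0 < g x y \<and> snd (s y) < g x y)"

definition best_object :: "('a \<Rightarrow> 'a \<Rightarrow> real) \<Rightarrow> ('a \<Rightarrow> 'a option \<times> real) \<Rightarrow> 'a \<Rightarrow> 'a \<Rightarrow> bool" where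
  "best_object g s x y \<longleftrightarrow> 0 < g x y \<and> snd (s y) < g x y \<and>
    (\<forall>z. 0 < g x z \<longrightarrow> g x z - snd (s z) \<le> g x y - snd (s y))"

text \<open>The choices made by \<open>SOME\<close> depend only on local data, so that an auction replayed on an explored
  ball makes the same ones.\<close>

definition bidders :: "'a set \<Rightarrow> ('a \<Rightarrow> 'a \<Rightarrow> real) \<Rightarrow> ('a \<Rightarrow> 'a option \<times> real) \<Rightarrow> 'a \<Rightarrow> 'a set" where
  "bidders L g s y =
    {x \<in> L. 0 < g y x \<and> auction_bids g s x \<and> (SOME z. best_object g s x z) = y}"

text \<open>All nodes bid simultaneously. One bidder wins and displaces the previous owner, and the
  price rises by exactly \<open>\<eta>\<close> however many bid.\<close>

definition auction_step ::
  "'a set \<Rightarrow> real \<Rightarrow> ('a \<Rightarrow> 'a \<Rightarrow> real) \<Rightarrow> ('a \<Rightarrow> 'a option \<times> real) \<Rightarrow> 'a \<Rightarrow> 'a option \<times> real" where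
  "auction_step L \<eta> g s y =
    (if bidders L g s y = {} then s y
     else (Some (SOME x. x \<in> bidders L g s y), snd (s y) + \<eta>))"

definition auction ::
  "'a set \<Rightarrow> real \<Rightarrow> ('a \<Rightarrow> 'a \<Rightarrow> real) \<Rightarrow> nat \<Rightarrow> 'a \<Rightarrow> 'a option \<times> real" where
  "auction L \<eta> g t = (auction_step L \<eta> g ^^ t) (\<lambda>_. (None, 0))"

text \<open>The gain is read in the row of \<open>y\<close>, not in that of its owner, so that
  beyond the auction state only the row of \<open>y\<close> must be known.\<close>

definition owned_value ::
  "'a set \<Rightarrow> real \<Rightarrow> ('a \<Rightarrow> 'a \<Rightarrow> real) \<Rightarrow> nat \<Rightarrow> 'a \<Rightarrow> real" where
  "owned_value L \<eta> g t y =
    (case fst (auction L \<eta> g t y) of None \<Rightarrow> 0 | Some x \<Rightarrow> g y x)"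

section \<open>Balls in the graph of positive gains, and locality of the auction\<close>

definition grow :: "('a \<Rightarrow> 'a \<Rightarrow> real) \<Rightarrow> 'a set \<Rightarrow> 'a set" where
  "grow g A = A \<union> (\<Union>x\<in>A. {z. 0 < g x z})"

lemma auction_0 [simp]: "auction L \<eta> g 0 = (\<lambda>_. (None, 0))"
  by (simp add: auction_def)

lemma auction_Suc: "auction L \<eta> g (Suc t) = auction_step L \<eta> g (auction L \<eta> g t)"
  by (simp add: auction_def)

lemma subset_grow: "A \<subseteq> grow g A"
  by (auto simp: grow_def)

lemma subset_funpow_grow: "A \<subseteq> (grow g ^^ n) A"
proof (induction n)
  case (Suc n)
  then show ?case using subset_grow[of "(grow g ^^ n) A" g] by simp
qed simp

lemma finite_funpow_grow:
  assumes "finite A" and "\<And>x. finite {z. 0 < g x z}"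
  shows "finite ((grow g ^^ n) A)"
  by (induction n) (use assms in \<open>auto simp: grow_def\<close>)

lemma card_funpow_grow:
  assumes "finite A" and "\<And>x. finite {z. 0 < g x z}" and "\<And>x. card {z. 0 < g x z} \<le> \<Delta>"
  shows "card ((grow g ^^ n) A) \<le> card A * (1 + \<Delta>) ^ n"
proof (induction n)
  case (Suc n)
  let ?B = "(grow g ^^ n) A"
  have "finite ?B" using finite_funpow_grow assms by blast
  have "card (grow g ?B) \<le> card ?B + card (\<Union>x\<in>?B. {z. 0 < g x z})"
    unfolding grow_def by (rule card_Un_le)
  also have "card (\<Union>x\<in>?B. {z. 0 < g x z}) \<le> (\<Sum>x\<in>?B. card {z. 0 < g x z})"
    using \<open>finite ?B\<close> by (rule card_UN_le)
  also have "\<dots> \<le> card ?B * \<Delta>"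
    using sum_bounded_above[of ?B "\<lambda>x. card {z. 0 < g x z}" \<Delta>] assms(3) by simp
  also have "card ?B + card ?B * \<Delta> = card ?B * (1 + \<Delta>)" by simp
  also have "\<dots> \<le> card A * (1 + \<Delta>) ^ n * (1 + \<Delta>)"
    using Suc by (rule mult_right_mono) simp
  finally show ?case by (simp add: mult_ac)
qed simp

text \<open>One round has radius 2: a bid of \<open>x\<close> for \<open>y\<close> depends on the
  neighbours of \<open>x\<close>, which lie two steps from \<open>y\<close>. Adjacency to
  \<open>y\<close> is tested in the row of \<open>y\<close>, so symmetry is not assumed; a partially
  explored gain function need not be symmetric.\<close>

lemma bidders_cong:
  assumes "g y = h y" and "\<And>x. 0 < g y x \<Longrightarrow> g x = h x"
    and "\<And>x z. 0 < g y x \<Longrightarrow> 0 < g x z \<Longrightarrow> s z = s' z"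
  shows "bidders L g s y = bidders L h s' y"
proof -
  have "auction_bids g s x \<longleftrightarrow> auction_bids h s' x" "best_object g s x = best_object h s' x"
    if "0 < g y x" for x
  proof -
    have *: "g x = h x" "\<And>z. 0 < h x z \<Longrightarrow> s z = s' z"
      using assms(2,3) that by auto
    show "auction_bids g s x \<longleftrightarrow> auction_bids h s' x"
      unfolding auction_bids_def *(1) by (simp add: *(2) cong: conj_cong)
    show "best_object g s x = best_object h s' x"
      unfolding best_object_def *(1) fun_eq_iff by (simp add: *(2) cong: conj_cong)
  qed
  then show ?thesis
    unfolding bidders_def assms(1)[symmetric] by (simp cong: conj_cong)
qed

text \<open>Induction with \<open>A\<close> general: the last round needs the earlier states on
  \<open>grow g (grow g A)\<close>, whose ball of radius \<open>2 * t\<close> is the ball of radius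
  \<open>2 * Suc t\<close> around \<open>A\<close>.\<close>

lemma auction_local:
  assumes "\<And>x. x \<in> (grow g ^^ (2 * t)) A \<Longrightarrow> g x = h x" and "y \<in> A"
  shows "auction L \<eta> g t y = auction L \<eta> h t y"
  using assms
proof (induction t arbitrary: A y)
  case (Suc t)
  let ?A = "grow g (grow g A)"
  have eq: "(grow g ^^ (2 * Suc t)) A = (grow g ^^ (2 * t)) ?A"
    using funpow_add[of "2 * t" 2 "grow g"] by (simp add: numeral_2_eq_2)
  note gh = Suc.prems(1)[unfolded eq]
  have IH: "auction L \<eta> g t z = auction L \<eta> h t z" if "z \<in> ?A" for z
    by (rule Suc.IH[OF gh that])
  have *: "g x = h x" if "x \<in> ?A" for x
    by (rule gh[OF subsetD[OF subset_funpow_grow that]])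
  have y: "y \<in> ?A"
    using Suc.prems(2) by (auto simp: grow_def)
  have x: "x \<in> ?A" if "0 < g y x" for x
    using Suc.prems(2) that by (auto simp: grow_def)
  have z: "z \<in> ?A" if "0 < g y x" "0 < g x z" for x z
    using Suc.prems(2) that unfolding grow_def by blast
  have "bidders L g (auction L \<eta> g t) y = bidders L h (auction L \<eta> h t) y"
  proof (rule bidders_cong)
    show "g y = h y" by (rule *[OF y])
    show "g x = h x" if "0 < g y x" for x by (rule *[OF x[OF that]])
    show "auction L \<eta> g t z = auction L \<eta> h t z" if "0 < g y x" "0 < g x z" for x z
      by (rule IH[OF z[OF that]])
  qed
  with IH[OF y] show ?case
    unfolding auction_Suc auction_step_def by simp
qed simp

lemma owned_value_local:
  assumes "\<And>x. x \<in> (grow g ^^ (2 * t)) A \<Longrightarrow> g x = h x" and "y \<in> A"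
  shows "owned_value L \<eta> g t y = owned_value L \<eta> h t y"
proof -
  have "g y = h y" using assms subset_funpow_grow[of A "2 * t" g] by auto
  then show ?thesis
    unfolding owned_value_def using auction_local[of t g A h y L \<eta>, OF assms]
    by (simp split: option.split)
qed

section \<open>Best bids in a bipartite gain graph\<close>

locale gain_graph =
  fixes L R :: "'a set" and g :: "'a \<Rightarrow> 'a \<Rightarrow> real"
  assumes fin: "finite L" "finite R"
    and bip: "0 < g x y \<Longrightarrow> (x \<in> L \<and> y \<in> R) \<or> (x \<in> R \<and> y \<in> L)"
    and disj: "L \<inter> R = {}"
    and sym: "g x y = g y x"
    and le2: "g x y \<le> 2"
    and nonneg: "0 \<le> g x y"
begin

lemma finite_nbrs: "finite {y. 0 < g x y}"
  by (rule finite_subset[of _ "L \<union> R"]) (use bip fin in auto)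

lemma nbr_R: "x \<in> L \<Longrightarrow> 0 < g x y \<Longrightarrow> y \<in> R"
  using bip disj by blast

lemma best_object_ex:
  assumes "auction_bids g s x"
  shows "best_object g s x (SOME y. best_object g s x y)"
proof (rule someI_ex)
  let ?N = "{y. 0 < g x y}" and ?f = "\<lambda>y. g x y - snd (s y)"
  obtain y0 where y0: "0 < g x y0" "snd (s y0) < g x y0"
    using assms by (auto simp: auction_bids_def)
  then have "Max (?f ` ?N) \<in> ?f ` ?N"
    using finite_nbrs by (intro Max_in) auto
  then obtain y where y: "y \<in> ?N" "?f y = Max (?f ` ?N)"
    by force
  then have max: "?f z \<le> ?f y" if "0 < g x z" for z
    using finite_nbrs[of x] that by simp
  \<comment> \<open>The maximal surplus is positive because that of \<open>y0\<close> is.\<close>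
  with y y0 show "\<exists>y. best_object g s x y"
    unfolding best_object_def using max[OF y0(1)] by force
qed

lemma bidders_best: "x \<in> bidders L g s y \<Longrightarrow> best_object g s x y"
  using best_object_ex by (auto simp: bidders_def)

lemma bidder_of_best:
  assumes "x \<in> L" "auction_bids g s x"
  shows "(SOME y. best_object g s x y) \<in> R" and "x \<in> bidders L g s (SOME y. best_object g s x y)"
  using best_object_ex[OF assms(2)] assms nbr_R sym[of x]
  by (auto simp: bidders_def best_object_def)

end

section \<open>Invariants of the auction and its dual certificate\<close>

locale gain_auction = gain_graph +
  fixes \<eta> :: real
  assumes \<eta>: "0 < \<eta>"
begin

abbreviation owner :: "nat \<Rightarrow> 'a \<Rightarrow> 'a option" where
  "owner t y \<equiv> fst (auction L \<eta> g t y)"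

abbreviation price :: "nat \<Rightarrow> 'a \<Rightarrow> real" where
  "price t y \<equiv> snd (auction L \<eta> g t y)"

abbreviation active :: "nat \<Rightarrow> 'a set" where
  "active t \<equiv> {x \<in> L. auction_bids g (auction L \<eta> g t) x}"

abbreviation receiving :: "nat \<Rightarrow> 'a set" where
  "receiving t \<equiv> {y \<in> R. bidders L g (auction L \<eta> g t) y \<noteq> {}}"

lemma bidders_subset: "bidders L g s y \<subseteq> L"
  by (auto simp: bidders_def)

lemma price_Suc:
  "price (Suc t) y = price t y + (if bidders L g (auction L \<eta> g t) y = {} then 0 else \<eta>)"
  by (simp add: auction_Suc auction_step_def)

lemma owner_Suc_cases:
  assumes "owner (Suc t) y = Some x"
  obtains (old) "owner t y = Some x" "price (Suc t) y = price t y"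
  | (new) "x \<in> bidders L g (auction L \<eta> g t) y" "price (Suc t) y = price t y + \<eta>"
  using assms
  by (fastforce simp: auction_Suc auction_step_def some_in_eq split: if_splits)

lemma price_mono: "price t y \<le> price (Suc t) y"
  using \<eta> by (simp add: price_Suc)

lemma price_nonneg: "0 \<le> price t y"
proof (induction t)
  case (Suc t)
  then show ?case using price_mono[of t y] by linarith
qed simp

text \<open>A node receives bids only while its price is below some gain, hence below 2, and a round
  adds at most \<open>\<eta>\<close>.\<close>

lemma price_le: "price t y \<le> 2 + \<eta>"
proof (induction t)
  case (Suc t)
  show ?case
  proof (cases "bidders L g (auction L \<eta> g t) y = {}")
    case False
    then obtain x where "x \<in> bidders L g (auction L \<eta> g t) y" by auto
    from bidders_best[OF this] have "price t y \<le> 2"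
      using le2[of x y] by (auto simp: best_object_def)
    with False show ?thesis by (simp add: price_Suc)
  qed (use Suc in \<open>simp add: price_Suc\<close>)
qed (use \<eta> in simp)

text \<open>A node that has once received a bid always keeps some owner, so an unowned one still has
  its initial price.\<close>

lemma price_unowned: "owner t y = None \<Longrightarrow> price t y = 0"
  by (induction t) (auto simp: auction_Suc auction_step_def split: if_splits)

lemma owner_adj:
  assumes "owner t y = Some x"
  shows "x \<in> L" and "y \<in> R" and "0 < g x y"
proof -
  have "x \<in> L \<and> 0 < g x y" using assms
  proof (induction t)
    case (Suc t)
    from Suc.prems show ?case
      by (cases rule: owner_Suc_cases) (use Suc.IH sym in \<open>auto simp: bidders_def\<close>)
  qed simp
  then show "x \<in> L" "y \<in> R" "0 < g x y" using nbr_R by auto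
qed

text \<open>A bidder owns nothing when it bids, and it bids for a single node, so no round can give
  it a second one.\<close>

lemma owner_inj:
  assumes "owner t y = Some x" "owner t z = Some x"
  shows "y = z"
  using assms
proof (induction t)
  case (Suc t)
  have new: "owner t b \<noteq> Some x" if "x \<in> bidders L g (auction L \<eta> g t) a" for a b
    using that owner_adj(3)[of t b x] by (auto simp: bidders_def auction_bids_def)
  from Suc.prems(1) show ?case
  proof (cases rule: owner_Suc_cases)
    case old
    from Suc.prems(2) show ?thesis
      by (cases rule: owner_Suc_cases) (use old new Suc.IH in auto)
  next
    case new': new
    from Suc.prems(2) show ?thesis
      by (cases rule: owner_Suc_cases) (use new' new in \<open>auto simp: bidders_def\<close>)
  qed
qed simp

text \<open>Complementary slackness up to \<open>\<eta>\<close>: when \<open>x\<close> won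
  \<open>y\<close>, it was a best choice and its price then rose by \<open>\<eta>\<close>. While
  \<open>x\<close> keeps \<open>y\<close> that price is fixed, and all other prices can only
  rise.\<close>

lemma owner_slack:
  assumes "owner t y = Some x"
  shows "0 \<le> g x y - price t y + \<eta>"
    and "0 < g x z \<Longrightarrow> g x z - price t z \<le> g x y - price t y + \<eta>"
proof -
  have "0 \<le> g x y - price t y + \<eta> \<and>
    (\<forall>z. 0 < g x z \<longrightarrow> g x z - price t z \<le> g x y - price t y + \<eta>)"
    using assms
  proof (induction t)
    case (Suc t)
    from Suc.prems show ?case
    proof (cases rule: owner_Suc_cases)
      case old
      have "g x z - price (Suc t) z \<le> g x y - price (Suc t) y + \<eta>" if "0 < g x z" for z
        using Suc.IH[OF old(1)] price_mono[of t z] old(2) that by fastforce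
      with Suc.IH[OF old(1)] old(2) show ?thesis by simp
    next
      case new
      have best: "best_object g (auction L \<eta> g t) x y"
        using new(1) bidders_best by blast
      have "g x z - price (Suc t) z \<le> g x y - price (Suc t) y + \<eta>" if "0 < g x z" for z
        using best price_mono[of t z] new(2) that unfolding best_object_def by fastforce
      with best new(2) show ?thesis unfolding best_object_def by auto
    qed
  qed simp
  then show "0 \<le> g x y - price t y + \<eta>"
    "0 < g x z \<Longrightarrow> g x z - price t z \<le> g x y - price t y + \<eta>" by auto
qed

text \<open>The dual variable of \<open>x\<close>. By \<open>owner_inj\<close> the sum has at most
  one term, and none if \<open>x\<close> owns nothing. An active node gets the largest possible gain
  2, which satisfies its constraints at any prices.\<close>

definition profit :: "nat \<Rightarrow> 'a \<Rightarrow> real" where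
  "profit t x = (\<Sum>y \<in> {y \<in> R. owner t y = Some x}. g x y - price t y + \<eta>)
     + (if x \<in> active t then 2 else 0)"

text \<open>An owner is covered by \<open>owner_slack\<close> and an active node by its bonus 2. Any
  other node sees only neighbours priced at their gain or higher.\<close>

lemma dual_feasible:
  assumes "x \<in> L"
  shows "g x y \<le> profit t x + price t y"
proof -
  let ?S = "{y \<in> R. owner t y = Some x}"
  have nn: "0 \<le> g x y - price t y + \<eta>" if "y \<in> ?S" for y
    using owner_slack(1) that by auto
  have pr: "0 \<le> profit t x"
    unfolding profit_def using sum_nonneg[of ?S, OF nn] by simp
  show ?thesis
  proof (cases "0 < g x y")
    case False
    with pr price_nonneg[of t y] show ?thesis by simp
  next
    case pos: True
    show ?thesis
    proof (cases "\<exists>z. owner t z = Some x")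
      case True
      then obtain z where z: "owner t z = Some x" by auto
      have "g x z - price t z + \<eta> \<le> (\<Sum>y \<in> ?S. g x y - price t y + \<eta>)"
        using z owner_adj fin nn
        by (intro member_le_sum[where f = "\<lambda>y. g x y - price t y + \<eta>"]) auto
      then have "g x z - price t z + \<eta> \<le> profit t x"
        unfolding profit_def by simp
      with owner_slack(2)[OF z pos] show ?thesis by simp
    next
      case un: False
      show ?thesis
      proof (cases "price t y < g x y")
        case True
        then have "x \<in> active t" using assms un pos by (auto simp: auction_bids_def)
        then have "2 \<le> profit t x"
          unfolding profit_def using nn sum_nonneg[of ?S "\<lambda>y. g x y - price t y + \<eta>"] by simp
        with le2[of x y] price_nonneg[of t y] show ?thesis by simp
      qed (use pr in simp)
    qed
  qed
qed

lemma owned_value_bounds: "0 \<le> owned_value L \<eta> g t y" "owned_value L \<eta> g t y \<le> 2"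
  using nonneg le2 by (auto simp: owned_value_def split: option.split)

text \<open>Regrouping the profits by owned node makes the prices cancel: an owned \<open>y\<close>
  contributes its gain plus \<open>\<eta>\<close>, an unowned one has price 0. Each active node adds
  2.\<close>

lemma dual_le_primal:
  "(\<Sum>x\<in>L. profit t x) + (\<Sum>y\<in>R. price t y)
    \<le> (\<Sum>y\<in>R. owned_value L \<eta> g t y) + \<eta> * card R + 2 * card (active t)"
proof -
  have "(\<Sum>x\<in>L. \<Sum>y \<in> {y \<in> R. owner t y = Some x}. g x y - price t y + \<eta>)
      = (\<Sum>y\<in>R. \<Sum>x \<in> {x \<in> L. owner t y = Some x}. g x y - price t y + \<eta>)"
    by (rule sum.swap_restrict) (use fin in auto)
  also have "\<dots> + (\<Sum>y\<in>R. price t y)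
      \<le> (\<Sum>y\<in>R. owned_value L \<eta> g t y + \<eta>)"
    unfolding sum.distrib[symmetric]
  proof (rule sum_mono)
    fix y assume "y \<in> R"
    show "(\<Sum>x \<in> {x \<in> L. owner t y = Some x}. g x y - price t y + \<eta>) + price t y
      \<le> owned_value L \<eta> g t y + \<eta>"
    proof (cases "owner t y")
      case None
      then show ?thesis using \<eta> price_unowned[OF None] by (simp add: owned_value_def)
    next
      case (Some x)
      then have "{x \<in> L. owner t y = Some x} = {x}" using owner_adj[OF Some] by auto
      with Some sym[of x y] show ?thesis by (simp add: owned_value_def)
    qed
  qed
  finally have "(\<Sum>x\<in>L. \<Sum>y \<in> {y \<in> R. owner t y = Some x}. g x y - price t y + \<eta>)
      + (\<Sum>y\<in>R. price t y) \<le> (\<Sum>y\<in>R. owned_value L \<eta> g t y) + \<eta> * card R"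
    by (simp add: sum.distrib mult.commute)
  moreover have "(\<Sum>x\<in>L. if x \<in> active t then 2 else 0 :: real) = 2 * card (active t)"
    using fin by (simp add: sum.If_cases Int_def conj_commute)
  ultimately show ?thesis
    unfolding profit_def sum.distrib by linarith
qed

text \<open>Every bid raises a price, and prices stay below \<open>2 + \<eta>\<close>, so few bids are made in total.\<close>

lemma sum_active_le:
  assumes "\<And>x. card {y. 0 < g x y} \<le> \<Delta>"
  shows "\<eta> * (\<Sum>t<T. real (card (active t))) \<le> \<Delta> * ((2 + \<eta>) * card R)"
proof -
  \<comment> \<open>All bidders for one node are its neighbours, so a single price increase accounts
    for at most \<open>\<Delta>\<close> active nodes.\<close>
  have "card (active t) \<le> \<Delta> * card (receiving t)" for t
  proof -
    let ?B = "bidders L g (auction L \<eta> g t)"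
    have "active t \<subseteq> (\<Union>y \<in> receiving t. ?B y)"
      using bidder_of_best by fastforce
    then have "card (active t) \<le> card (\<Union>y \<in> receiving t. ?B y)"
      by (rule card_mono[rotated]) (use fin(1,2) finite_subset[OF bidders_subset fin(1)] in simp)
    also have "\<dots> \<le> (\<Sum>y \<in> receiving t. card (?B y))"
      by (rule card_UN_le) (use fin in auto)
    also have "\<dots> \<le> (\<Sum>y \<in> receiving t. \<Delta>)"
    proof (rule sum_mono)
      fix y
      have "card (?B y) \<le> card {x. 0 < g y x}"
        by (rule card_mono[OF finite_nbrs]) (auto simp: bidders_def)
      with assms[of y] show "card (?B y) \<le> \<Delta>" by simp
    qed
    finally show ?thesis by (simp add: mult.commute)
  qed
  then have 1: "real (card (active t)) \<le> \<Delta> * real (card (receiving t))" for t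
    unfolding of_nat_mult[symmetric] of_nat_le_iff .
  have 2: "\<eta> * real (card (receiving t)) = (\<Sum>y\<in>R. price (Suc t) y) - (\<Sum>y\<in>R. price t y)" for t
    using fin by (simp add: price_Suc sum.distrib sum.If_cases Int_def mult.commute)
  have "\<eta> * (\<Sum>t<T. real (card (active t))) \<le> \<eta> * (\<Sum>t<T. \<Delta> * real (card (receiving t)))"
    using 1 \<eta> by (intro mult_left_mono sum_mono) auto
  also have "\<dots> = \<Delta> * (\<Sum>t<T. \<eta> * real (card (receiving t)))"
    by (simp add: sum_distrib_left mult_ac)
  also have "(\<Sum>t<T. \<eta> * real (card (receiving t))) = (\<Sum>y\<in>R. price T y) - (\<Sum>y\<in>R. price 0 y)"
    unfolding 2 by (rule sum_lessThan_telescope)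
  also have "\<dots> \<le> (\<Sum>y\<in>R. 2 + \<eta>)"
    using sum_mono[of R "price T" "\<lambda>_. 2 + \<eta>"] price_le by simp
  also have "\<dots> = (2 + \<eta>) * card R" by simp
  finally show ?thesis by (simp add: mult_left_mono)
qed

end

section \<open>Bounds on the transport cost of an edge\<close>

lemma nbrs_iff: "y \<in> nbrs G x \<longleftrightarrow> (x, y) \<in> parcs G"
  by (simp add: nbrs_def)

section \<open>Distances along walks\<close>

context pair_graph
begin

lemma finite_nbrs: "finite (nbrs G x)"
  by (rule finite_subset[OF _ pair_finite_verts]) (auto simp: nbrs_iff dest: in_arcsD2)

lemma nbrs_sym: "y \<in> nbrs G x \<longleftrightarrow> x \<in> nbrs G y"
  using sym_arcs by (auto simp: nbrs_iff symmetric_def sym_def)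

lemma not_nbrs_self: "x \<notin> nbrs G x"
  using pair_no_loops by (fastforce simp: nbrs_iff)

lemma gdist_le: "awalk x p y \<Longrightarrow> gdist G x y \<le> length p"
  unfolding gdist_def by (rule Least_le) blast

lemma gdist_awalk:
  assumes "awalk x p y"
  obtains q where "awalk x q y" "length q = gdist G x y"
  using LeastI_ex[of "\<lambda>n. \<exists>p. awalk x p y \<and> length p = n"] assms
  unfolding gdist_def by blast

lemma gdist_triangle:
  assumes "awalk x p y" "awalk y q z"
  shows "gdist G x z \<le> gdist G x y + gdist G y z"
proof -
  obtain p' q' where "awalk x p' y" "length p' = gdist G x y"
    "awalk y q' z" "length q' = gdist G y z"
    using gdist_awalk[OF assms(1)] gdist_awalk[OF assms(2)] by metis
  then show ?thesis using gdist_le[OF awalk_appendI, of x p' y q' z] by simp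
qed

lemma gdist_eq_0:
  assumes "awalk x p y" "gdist G x y = 0"
  shows "x = y"
  using gdist_awalk[OF assms(1)] assms(2) by (metis awalk_Nil_iff length_0_conv)

lemma awalk_nbr: "y \<in> nbrs G x \<Longrightarrow> awalk x [(x, y)] y"
  by (auto simp: nbrs_iff awalk_simps dest: in_arcsD1 in_arcsD2)

lemma ex_awalk_trans: "\<exists>p. awalk x p y \<Longrightarrow> \<exists>p. awalk y p z \<Longrightarrow> \<exists>p. awalk x p z"
  by (elim exE) (rule exI, rule awalk_appendI)

end

section \<open>The two supports at an edge and the distances between them\<close>

locale graph_edge = pair_graph G for G :: "'a pair_pre_digraph" +
  fixes u v :: 'a
  assumes edge: "(u, v) \<in> parcs G" and deg_eq: "deg G u = deg G v"
begin

abbreviation "L \<equiv> left_part (edge_bip G u v)"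
abbreviation "R \<equiv> right_part (edge_bip G u v)"
abbreviation "source \<equiv> {u} \<union> nbrs G u"
abbreviation "target \<equiv> {v} \<union> nbrs G v"
text \<open>This contains \<open>u\<close> and \<open>v\<close> besides the shared neighbours, since
  each endpoint is adjacent to the other.\<close>

definition "common = source \<inter> target"

lemma L_def: "L = nbrs G u - (nbrs G v \<union> {v})" and R_def: "R = nbrs G v - (nbrs G u \<union> {u})"
  by (simp_all add: edge_bip_def)

lemma uv: "v \<in> nbrs G u" "u \<in> nbrs G v"
  using edge nbrs_sym[of v u] by (simp_all add: nbrs_iff)

lemma source_eq: "source = common \<union> L" "common \<inter> L = {}"
  using uv not_nbrs_self[of u] by (auto simp: L_def common_def)

lemma target_eq: "target = common \<union> R" "common \<inter> R = {}"
  using uv not_nbrs_self[of v] by (auto simp: R_def common_def)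

lemma finite_parts: "finite source" "finite target" "finite common" "finite L" "finite R"
  using finite_nbrs by (auto simp: L_def R_def common_def)

lemma sum_source:
  fixes f :: "'a \<Rightarrow> real"
  shows "sum f source = sum f common + sum f L"
  using sum.union_disjoint[OF finite_parts(3,4) source_eq(2), of f]
  unfolding source_eq(1)[symmetric] .

lemma sum_target:
  fixes f :: "'a \<Rightarrow> real"
  shows "sum f target = sum f common + sum f R"
  using sum.union_disjoint[OF finite_parts(3,5) target_eq(2), of f]
  unfolding target_eq(1)[symmetric] .

lemma card_source: "card source = 1 + deg G u" and card_target: "card target = 1 + deg G u"
  using finite_nbrs not_nbrs_self deg_eq by auto

text \<open>By equality of degrees the two supports have the same size, and both lose the same
  common part.\<close>

lemma card_parts: "card L = card R"
proof -
  have "card source = card common + card L"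
    using source_eq finite_parts card_Un_disjoint by metis
  moreover have "card target = card common + card R"
    using target_eq finite_parts card_Un_disjoint by metis
  ultimately show ?thesis using card_source card_target by simp
qed

lemma card_R_le: "card R \<le> 1 + deg G u"
  using card_mono[OF finite_parts(2), of R] target_eq card_target by auto

lemma parts_disjoint: "L \<inter> R = {}"
  by (auto simp: L_def R_def)

text \<open>\<open>gdist\<close> is meaningful only where a walk exists; here every walk is routed
  through \<open>u\<close>.\<close>

lemma ex_awalk:
  assumes x: "x \<in> source \<union> target" and y: "y \<in> source \<union> target"
  shows "\<exists>p. awalk x p y"
proof -
  have nbr: "\<exists>p. awalk a p b" "\<exists>p. awalk b p a" if "b \<in> nbrs G a" for a b
    using awalk_nbr[of b a] awalk_nbr[of a b] nbrs_sym[of b a] that by blast+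
  have refl: "\<exists>p. awalk u p u"
    using ex_awalk_trans[OF nbr(1)[OF uv(1)] nbr(2)[OF uv(1)]] .
  have "(\<exists>p. awalk z p u) \<and> (\<exists>p. awalk u p z)" if z: "z \<in> source \<union> target" for z
  proof -
    consider "z = u" | "z \<in> nbrs G u" | "z = v" | "z \<in> nbrs G v" using z by blast
    then show ?thesis
    proof cases
      case 4
      from nbr[OF this] nbr[OF uv(1)] show ?thesis
        using ex_awalk_trans[of z v u] ex_awalk_trans[of u v z] by blast
    qed (use refl nbr uv in blast)+
  qed
  with x y show ?thesis using ex_awalk_trans[of x u y] by blast
qed

lemma gdist_triangle':
  assumes "x \<in> source \<union> target" "y \<in> source \<union> target" "z \<in> source \<union> target"
  shows "gdist G x z \<le> gdist G x y + gdist G y z"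
proof -
  obtain p q where "awalk x p y" "awalk y q z"
    using ex_awalk[OF assms(1,2)] ex_awalk[OF assms(2,3)] by auto
  then show ?thesis by (rule gdist_triangle)
qed

lemma gdist_self:
  assumes "x \<in> source \<union> target"
  shows "gdist G x x = 0"
proof -
  obtain p where "awalk x p x" using ex_awalk[OF assms assms] by auto
  then have "awalk x [] x" by (auto simp: awalk_Nil_iff dest: awalk_hd_in_verts)
  from gdist_le[OF this] show ?thesis by simp
qed

lemma gdist_pos:
  assumes "x \<in> L" "y \<in> R"
  shows "0 < gdist G x y"
proof -
  have "x \<in> source \<union> target" "y \<in> source \<union> target" "x \<noteq> y"
    using assms by (auto simp: L_def R_def)
  moreover obtain p where "awalk x p y"
    using ex_awalk[OF calculation(1,2)] by auto
  ultimately show ?thesis using gdist_eq_0[of x p y] by auto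
qed

lemma gdist_le_3:
  assumes "x \<in> L" "y \<in> R"
  shows "gdist G x y \<le> 3"
proof -
  have "u \<in> nbrs G x" "y \<in> nbrs G v"
    using assms nbrs_sym[of u x] by (simp_all add: L_def R_def)
  then have "awalk x [(x, u)] u" "awalk u [(u, v)] v" "awalk v [(v, y)] y"
    using uv(1) by (simp_all add: awalk_nbr)
  then have "awalk x ([(x, u)] @ [(u, v)] @ [(v, y)]) y"
    by (intro awalk_appendI)
  from gdist_le[OF this] show ?thesis by simp
qed

section \<open>Primal and dual bounds for the transport problem\<close>

definition transport_cost :: "('a \<Rightarrow> 'a \<Rightarrow> real) \<Rightarrow> real" where
  "transport_cost z = (\<Sum>x \<in> source. \<Sum>y \<in> target. real (gdist G x y) * z x y)"

text \<open>The product of the two uniform marginals is a plan. Lower bounds on the infimum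
  \<open>emd\<close> rely on this.\<close>

lemma transport_plans_nonempty: "transport_plans G u v \<noteq> {}"
proof -
  define q where "q = 1 / (1 + real (deg G u))"
  have "1 + real (deg G u) \<noteq> 0" by linarith
  then have "(1 + real (deg G u)) * (q * q) = q" by (simp add: q_def)
  then have "(\<lambda>x y. q * q) \<in> transport_plans G u v"
    unfolding transport_plans_def mem_Collect_eq sum_constant card_source card_target deg_eq[symmetric]
    by (simp add: q_def[symmetric])
  then show ?thesis by blast
qed

lemma transport_cost_nonneg:
  assumes "z \<in> transport_plans G u v"
  shows "0 \<le> transport_cost z"
  unfolding transport_cost_def using assms
  by (auto simp: transport_plans_def intro!: sum_nonneg mult_nonneg_nonneg)

lemma emd_le:
  assumes "z \<in> transport_plans G u v"
  shows "emd G u v \<le> transport_cost z"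
  unfolding emd_def transport_cost_def[symmetric]
  by (rule cINF_lower[OF _ assms]) (auto intro!: bdd_belowI[of _ 0] transport_cost_nonneg)

text \<open>Extending \<open>\<sigma>\<close> by the identity on \<open>common\<close> gives a
  bijection of the supports. As all points carry equal mass, moving each along it is a plan, and the
  common part costs nothing.\<close>

lemma emd_le_bijection:
  assumes "bij_betw \<sigma> L R"
  shows "(1 + real (deg G u)) * emd G u v \<le> (\<Sum>x\<in>L. real (gdist G x (\<sigma> x)))"
proof -
  define \<tau> where "\<tau> x = (if x \<in> L then \<sigma> x else x)" for x
  have cL: "x \<notin> L" if "x \<in> common" for x using source_eq that by blast
  have "bij_betw \<tau> (common \<union> L) (common \<union> R)"
  proof (rule bij_betw_combine)
    show "bij_betw \<tau> common common"
      by (rule bij_betw_cong[THEN iffD2, of _ _ id]) (use cL in \<open>auto simp: \<tau>_def\<close>)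
    show "bij_betw \<tau> L R"
      using assms by (rule bij_betw_cong[THEN iffD1, rotated]) (auto simp: \<tau>_def)
    show "common \<inter> R = {}" using target_eq by simp
  qed
  then have \<tau>: "bij_betw \<tau> source target"
    using source_eq target_eq by simp
  define w where "w = 1 / (1 + real (deg G u))"
  define z where "z x y = (if y = \<tau> x then w else 0)" for x y
  have \<tau>_in: "\<tau> x \<in> target" if "x \<in> source" for x
    using \<tau> that by (rule bij_betw_apply)
  have col: "(\<Sum>x\<in>source. z x y) = w" if "y \<in> target" for y
  proof -
    have "y \<in> \<tau> ` source"
      unfolding bij_betw_imp_surj_on[OF \<tau>] by (rule that)
    then obtain x where x: "y = \<tau> x" "x \<in> source" by (rule imageE)
    have "(\<Sum>x'\<in>source. z x' y) = (\<Sum>x'\<in>source. if x' = x then w else 0)"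
    proof (rule sum.cong[OF refl])
      fix x' assume "x' \<in> source"
      from inj_on_eq_iff[OF bij_betw_imp_inj_on[OF \<tau>] x(2) this]
      show "z x' y = (if x' = x then w else 0)" unfolding z_def x(1) by simp
    qed
    also have "\<dots> = w"
      unfolding sum.delta[OF finite_parts(1)] using x(2) by (rule if_P)
    finally show ?thesis .
  qed
  have row: "(\<Sum>y\<in>target. f y * z x y) = f (\<tau> x) * w" if "x \<in> source" for f x
  proof -
    have "(\<Sum>y\<in>target. f y * z x y) = (\<Sum>y\<in>target. if y = \<tau> x then f y * w else 0)"
      unfolding z_def by (rule sum.cong) auto
    also have "\<dots> = f (\<tau> x) * w"
      unfolding sum.delta[OF finite_parts(2)] using \<tau>_in[OF that] by (rule if_P)
    finally show ?thesis .
  qed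
  have nonneg: "0 \<le> z x y" for x y
    by (simp add: z_def w_def)
  have row': "(\<Sum>y\<in>target. z x y) = w" if "x \<in> source" for x
    using row[OF that, of "\<lambda>_. 1"] by simp
  have "z \<in> transport_plans G u v"
    unfolding transport_plans_def mem_Collect_eq deg_eq[symmetric] w_def[symmetric]
    using nonneg row' col by blast
  then have "emd G u v \<le> transport_cost z" by (rule emd_le)
  also have "\<dots> = (\<Sum>x\<in>source. real (gdist G x (\<tau> x)) * w)"
    unfolding transport_cost_def by (rule sum.cong[OF refl row])
  also have "\<dots> = (\<Sum>x\<in>common. real (gdist G x (\<tau> x)) * w) + (\<Sum>x\<in>L. real (gdist G x (\<tau> x)) * w)"
    by (rule sum_source)
  also have "(\<Sum>x\<in>common. real (gdist G x (\<tau> x)) * w) = 0"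
    using cL gdist_self by (intro sum.neutral) (auto simp: \<tau>_def common_def)
  also have "(\<Sum>x\<in>L. real (gdist G x (\<tau> x)) * w) = (\<Sum>x\<in>L. real (gdist G x (\<sigma> x))) * w"
    by (simp add: \<tau>_def sum_distrib_right)
  finally show ?thesis by (simp add: w_def pos_le_divide_eq mult.commute add_pos_nonneg)
qed

text \<open>The common mass stays in place and a partial matching of \<open>L\<close> into \<open>R\<close> extends to a bijection,
  whose remaining pairs are at distance at most 3.\<close>

lemma emd_le_matching:
  fixes f :: "'a \<Rightarrow> real"
  assumes owner: "\<And>x y. own y = Some x \<Longrightarrow> x \<in> L \<and> y \<in> R"
    and inj: "\<And>x y z. own y = Some x \<Longrightarrow> own z = Some x \<Longrightarrow> y = z"
    and gain: "\<And>x y. own y = Some x \<Longrightarrow> real (gdist G x y) \<le> 3 - f y"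
  shows "(1 + real (deg G u)) * emd G u v
    \<le> 3 * real (card R) - (\<Sum>y\<in>R. case own y of None \<Rightarrow> 0 | Some x \<Rightarrow> f y)"
proof -
  define Y where "Y = {y \<in> R. own y \<noteq> None}"
  define \<mu> where "\<mu> y = the (own y)" for y
  have inj_\<mu>: "inj_on \<mu> Y" using inj by (auto simp: inj_on_def Y_def \<mu>_def)
  have \<mu>_L: "\<mu> ` Y \<subseteq> L" using owner by (auto simp: Y_def \<mu>_def)
  have "card (R - Y) = card (L - \<mu> ` Y)"
  proof -
    have "Y \<subseteq> R" "finite Y" using finite_parts(5) by (auto simp: Y_def)
    then show ?thesis
      using card_parts card_image[OF inj_\<mu>] by (simp add: card_Diff_subset \<mu>_L)
  qed
  then obtain \<nu> where \<nu>: "bij_betw \<nu> (R - Y) (L - \<mu> ` Y)"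
    using finite_same_card_bij[of "R - Y" "L - \<mu> ` Y"] finite_parts(4,5) by auto
  define \<rho> where "\<rho> y = (if y \<in> Y then \<mu> y else \<nu> y)" for y
  have "bij_betw \<rho> (Y \<union> (R - Y)) (\<mu> ` Y \<union> (L - \<mu> ` Y))"
  proof (rule bij_betw_combine)
    show "bij_betw \<rho> Y (\<mu> ` Y)"
      using inj_on_imp_bij_betw[OF inj_\<mu>]
      by (rule bij_betw_cong[THEN iffD1, rotated]) (auto simp: \<rho>_def)
    show "bij_betw \<rho> (R - Y) (L - \<mu> ` Y)"
      using \<nu> by (rule bij_betw_cong[THEN iffD1, rotated]) (auto simp: \<rho>_def)
  qed auto
  moreover have "Y \<union> (R - Y) = R" "\<mu> ` Y \<union> (L - \<mu> ` Y) = L"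
    using \<mu>_L by (auto simp: Y_def)
  ultimately have \<rho>: "bij_betw \<rho> R L" by simp
  have "(1 + real (deg G u)) * emd G u v \<le> (\<Sum>x\<in>L. real (gdist G x (inv_into R \<rho> x)))"
    by (rule emd_le_bijection[OF bij_betw_inv_into[OF \<rho>]])
  also have "\<dots> = (\<Sum>y\<in>R. real (gdist G (\<rho> y) (inv_into R \<rho> (\<rho> y))))"
    by (rule sum.reindex_bij_betw[OF \<rho>, symmetric])
  also have "\<dots> = (\<Sum>y\<in>R. real (gdist G (\<rho> y) y))"
    by (intro sum.cong refl) (simp add: inv_into_f_f[OF bij_betw_imp_inj_on[OF \<rho>]])
  also have "\<dots> \<le> (\<Sum>y\<in>R. 3 - (case own y of None \<Rightarrow> 0 | Some x \<Rightarrow> f y))"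
  proof (rule sum_mono)
    fix y assume y: "y \<in> R"
    show "real (gdist G (\<rho> y) y) \<le> 3 - (case own y of None \<Rightarrow> 0 | Some x \<Rightarrow> f y)"
    proof (cases "own y")
      case None
      then show ?thesis
        using gdist_le_3[OF bij_betw_apply[OF \<rho> y] y] by simp
    next
      case (Some x)
      then show ?thesis using gain[OF Some] y by (simp add: \<rho>_def \<mu>_def Y_def)
    qed
  qed
  finally show ?thesis by (simp add: sum_subtractf)
qed

text \<open>Kantorovich duality for the metric \<open>gdist G\<close>: potentials feasible on \<open>L \<times> R\<close> extend to the
  1-Lipschitz potential \<open>F\<close>, which is charged with opposite signs at the two ends and therefore
  cancels on the common vertices.\<close>

lemma emd_ge_dual:
  assumes feas: "\<And>x y. x \<in> L \<Longrightarrow> y \<in> R \<Longrightarrow> \<alpha> x + \<beta> y \<le> real (gdist G x y)"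
  shows "(\<Sum>x\<in>L. \<alpha> x) + (\<Sum>y\<in>R. \<beta> y) \<le> (1 + real (deg G u)) * emd G u v"
proof (cases "R = {}")
  \<comment> \<open>The potential \<open>F\<close> is a minimum over \<open>R\<close>, so the empty
    case is separate and reduces to nonnegativity of the cost.\<close>
  case True
  then have "L = {}" using card_parts finite_parts by simp
  have "0 \<le> emd G u v"
    unfolding emd_def transport_cost_def[symmetric]
    by (intro cINF_greatest transport_plans_nonempty transport_cost_nonneg)
  with True \<open>L = {}\<close> show ?thesis by simp
next
  case False
  define F where "F a = (MIN y\<in>R. real (gdist G a y) - \<beta> y)" for a
  have RS: "y \<in> source \<union> target" if "y \<in> R" for y using that by (auto simp: R_def)
  have F_le: "F a \<le> real (gdist G a y) - \<beta> y" if "y \<in> R" for a y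
    unfolding F_def using finite_parts that by simp
  have F_lip: "F a - F b \<le> real (gdist G a b)"
    if "a \<in> source \<union> target" "b \<in> source \<union> target" for a b
  proof -
    have "F b \<in> (\<lambda>y. real (gdist G b y) - \<beta> y) ` R"
      unfolding F_def using finite_parts False by (intro Min_in) auto
    then obtain y where y: "y \<in> R" "F b = real (gdist G b y) - \<beta> y" by auto
    with F_le[OF y(1), of a] gdist_triangle'[OF that RS[OF y(1)]] show ?thesis by linarith
  qed
  \<comment> \<open>Feasibility puts \<open>\<alpha> x\<close> below every term of the
    minimum.\<close>
  have F_L: "\<alpha> x \<le> F x" if "x \<in> L" for x
    unfolding F_def using finite_parts False feas[OF that] by (auto simp: algebra_simps)
  \<comment> \<open>The minimum defining \<open>F y\<close> includes \<open>y\<close> itself, at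
    distance 0.\<close>
  have F_R: "\<beta> y \<le> - F y" if "y \<in> R" for y
    using F_le[OF that, of y] gdist_self[OF RS[OF that]] by simp
  have plan: "(\<Sum>x\<in>L. \<alpha> x) + (\<Sum>y\<in>R. \<beta> y) \<le> (1 + real (deg G u)) * transport_cost z"
    if z: "z \<in> transport_plans G u v" for z
  proof -
    let ?w = "1 / (1 + real (deg G u))"
    have "(\<Sum>x\<in>source. \<Sum>y\<in>target. (F x - F y) * z x y) \<le> transport_cost z"
      unfolding transport_cost_def using z F_lip
      by (intro sum_mono mult_right_mono) (auto simp: transport_plans_def)
    moreover have "(\<Sum>x\<in>source. \<Sum>y\<in>target. (F x - F y) * z x y)
      = (\<Sum>x\<in>source. F x * (\<Sum>y\<in>target. z x y)) - (\<Sum>x\<in>source. \<Sum>y\<in>target. F y * z x y)"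
      by (simp add: left_diff_distrib sum_subtractf sum_distrib_left)
    moreover have "(\<Sum>x\<in>source. \<Sum>y\<in>target. F y * z x y) = (\<Sum>y\<in>target. F y * (\<Sum>x\<in>source. z x y))"
      by (subst sum.swap) (simp add: sum_distrib_left)
    moreover have "(\<Sum>x\<in>source. F x * (\<Sum>y\<in>target. z x y)) = (\<Sum>x\<in>source. F x * ?w)"
      using z by (intro sum.cong) (auto simp: transport_plans_def)
    moreover have "(\<Sum>y\<in>target. F y * (\<Sum>x\<in>source. z x y)) = (\<Sum>y\<in>target. F y * ?w)"
      using z deg_eq by (intro sum.cong) (auto simp: transport_plans_def)
    ultimately have "((\<Sum>x\<in>source. F x) - (\<Sum>y\<in>target. F y)) * ?w \<le> transport_cost z"
      by (simp only: left_diff_distrib sum_distrib_right)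
    then have "(\<Sum>x\<in>source. F x) - (\<Sum>y\<in>target. F y) \<le> (1 + real (deg G u)) * transport_cost z"
      by (simp add: pos_divide_le_eq mult.commute add_pos_nonneg)
    moreover note sum_source[of F] sum_target[of F]
    moreover have "(\<Sum>x\<in>L. \<alpha> x) \<le> (\<Sum>x\<in>L. F x)" by (intro sum_mono F_L)
    moreover have "(\<Sum>x\<in>R. \<beta> x) \<le> (\<Sum>x\<in>R. - F x)" by (intro sum_mono F_R)
    ultimately show ?thesis unfolding sum_negf by linarith
  qed
  have "((\<Sum>x\<in>L. \<alpha> x) + (\<Sum>y\<in>R. \<beta> y)) / (1 + real (deg G u)) \<le> emd G u v"
    unfolding emd_def transport_cost_def[symmetric]
  proof (rule cINF_greatest)
    show "transport_plans G u v \<noteq> {}" by (rule transport_plans_nonempty)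
    show "((\<Sum>x\<in>L. \<alpha> x) + (\<Sum>y\<in>R. \<beta> y)) / (1 + real (deg G u)) \<le> transport_cost z"
      if "z \<in> transport_plans G u v" for z
      using plan[OF that] by (simp add: pos_divide_le_eq mult.commute add_pos_nonneg)
  qed
  then show ?thesis by (simp add: pos_divide_le_eq mult.commute add_pos_nonneg)
qed

end

section \<open>Exploring balls by queries\<close>

text \<open>Subroutines take a continuation because outputs occur only at the leaves of a query
  tree. The number is a budget: a node with exactly that many neighbours is listed without a final
  query answered by \<open>None\<close>.\<close>

primrec gather ::
  "nat \<Rightarrow> 'a \<Rightarrow> nat \<Rightarrow> 'a set \<Rightarrow> ('a set \<Rightarrow> 'a query_alg) \<Rightarrow> 'a query_alg" where
  "gather 0 x s A k = k A"
| "gather (Suc n) x s A k =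
    Query x s (\<lambda>a. case a of None \<Rightarrow> k A | Some z \<Rightarrow> gather n x s (insert z A) k)"

definition row :: "'a set \<Rightarrow> 'a set \<Rightarrow> 'a \<Rightarrow> real" where
  "row A B z = (if z \<in> A then 2 else if z \<in> B then 1 else 0)"

definition gain :: "bool \<Rightarrow> 'a wbip \<Rightarrow> 'a \<Rightarrow> 'a \<Rightarrow> real" where
  "gain two H x = row (wnbrs H x 1) (if two then wnbrs H x 2 else {})"

definition probe :: "bool \<Rightarrow> nat \<Rightarrow> 'a \<Rightarrow> (('a \<Rightarrow> real) \<Rightarrow> 'a query_alg) \<Rightarrow> 'a query_alg" where
  "probe two D x k = gather D x 1 {} (\<lambda>A.
     if two then gather D x 2 {} (\<lambda>B. k (row A B)) else k (row A {}))"

primrec visit ::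
  "bool \<Rightarrow> nat \<Rightarrow> 'a list \<Rightarrow> ('a \<Rightarrow> 'a \<Rightarrow> real) \<Rightarrow> (('a \<Rightarrow> 'a \<Rightarrow> real) \<Rightarrow> 'a query_alg) \<Rightarrow> 'a query_alg"
where
  "visit two D [] c k = k c"
| "visit two D (x # xs) c k = probe two D x (\<lambda>r. visit two D xs (c(x := r)) k)"

definition list_of :: "'a set \<Rightarrow> 'a list" where
  "list_of A = (SOME xs. set xs = A \<and> distinct xs)"

text \<open>Breadth-first search: \<open>E\<close> has been visited, with its rows recorded in \<open>c\<close>, and \<open>F\<close> is the
  frontier.\<close>

primrec scan ::
  "bool \<Rightarrow> nat \<Rightarrow> nat \<Rightarrow> 'a set \<Rightarrow> 'a set \<Rightarrow> ('a \<Rightarrow> 'a \<Rightarrow> real)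
    \<Rightarrow> (('a \<Rightarrow> 'a \<Rightarrow> real) \<Rightarrow> 'a query_alg) \<Rightarrow> 'a query_alg"
where
  "scan two D 0 E F c k = visit two D (list_of F) c k"
| "scan two D (Suc r) E F c k = visit two D (list_of F) c
     (\<lambda>c'. scan two D r (E \<union> F) (grow c' (E \<union> F) - (E \<union> F)) c' k)"

text \<open>The knowledge after visiting \<open>E\<close>: each row is known completely or recorded
  as zero.\<close>

definition mask :: "('a \<Rightarrow> 'a \<Rightarrow> real) \<Rightarrow> 'a set \<Rightarrow> 'a \<Rightarrow> 'a \<Rightarrow> real" where
  "mask g E = (\<lambda>x. if x \<in> E then g x else (\<lambda>_. 0))"

text \<open>The query bound concerns every run, so it adds up under composition; it then bounds the
  expectation as well.\<close>

definition computes ::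
  "'a wbip \<Rightarrow> 'a query_alg \<Rightarrow> ('a \<Rightarrow> 'a set) \<Rightarrow> real pmf \<Rightarrow> nat \<Rightarrow> bool" where
  "computes H t X f B \<longleftrightarrow>
    map_pmf fst (run_from H t X) = f \<and> (\<forall>r \<in> set_pmf (run_from H t X). snd r \<le> B)"

section \<open>Correctness and cost of the exploration\<close>

lemma list_of: "finite A \<Longrightarrow> set (list_of A) = A \<and> distinct (list_of A)"
  unfolding list_of_def by (rule someI_ex) (rule finite_distinct_list)

lemma computes_mono: "computes H t X f B \<Longrightarrow> B \<le> B' \<Longrightarrow> computes H t X f B'"
  by (auto simp: computes_def intro: order_trans)

lemma computes_Output: "computes H (Output \<beta>) X (return_pmf \<beta>) 0"
  by (simp add: computes_def)

lemma computes_Choose: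
  assumes "\<And>i. i \<in> set_pmf p \<Longrightarrow> computes H (g i) X (f i) B"
  shows "computes H (Choose (map_pmf g p)) X (bind_pmf p f) B"
  using assms
  by (auto simp: computes_def map_bind_pmf bind_map_pmf intro!: bind_pmf_cong)

text \<open>All answers must lead to the same \<open>f\<close>: neighbours arrive in random order,
  but the set finally collected, and hence the output, does not depend on it.\<close>

lemma computes_Query:
  assumes "\<And>a. a \<in> set_pmf (answer H X x s) \<Longrightarrow> computes H (k a) (explore X x a) f B"
  shows "computes H (Query x s k) X f (Suc B)"
proof -
  have "map_pmf fst (run_from H (Query x s k) X) = bind_pmf (answer H X x s) (\<lambda>_. f)"
    unfolding run_from.simps map_bind_pmf
    by (rule bind_pmf_cong) (use assms in \<open>auto simp: computes_def pmf.map_comp o_def\<close>)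
  moreover have "snd r \<le> Suc B" if "r \<in> set_pmf (run_from H (Query x s k) X)" for r
    using that assms by (fastforce simp: computes_def)
  ultimately show ?thesis by (simp add: computes_def)
qed

text \<open>\<open>A\<close> holds the neighbours of weight \<open>s\<close> returned so far. It is
  the intersection with \<open>X x\<close> because \<open>X x\<close> may also contain nodes reached
  along another weight.\<close>

lemma computes_gather:
  assumes "finite (wnbrs H x s)" "card (wnbrs H x s - A) \<le> n" "A \<subseteq> wnbrs H x s"
    "X x \<inter> wnbrs H x s = A"
    "computes H (k (wnbrs H x s)) (X(x := X x \<union> wnbrs H x s)) f B"
  shows "computes H (gather n x s A k) X f (n + B)"
  using assms
proof (induction n arbitrary: A X)
  case 0
  then have "wnbrs H x s = A" by auto
  moreover from this 0(4) have "X(x := X x \<union> wnbrs H x s) = X"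
    by (intro fun_upd_idem) blast
  ultimately show ?case using 0 by simp
next
  case (Suc n)
  let ?W = "wnbrs H x s"
  have "computes H (case a of None \<Rightarrow> k A | Some z \<Rightarrow> gather n x s (insert z A) k)
      (explore X x a) f (n + B)" if a: "a \<in> set_pmf (answer H X x s)" for a
  proof (cases "?W - X x = {}")
    case True
    then have "a = None" "?W = A" using a Suc.prems by (auto simp: answer_def)
    moreover from this Suc.prems(4) have "X(x := X x \<union> ?W) = X"
      by (intro fun_upd_idem) blast
    ultimately show ?thesis
      using computes_mono[OF Suc.prems(5), of "n + B"] by (simp add: explore_def)
  next
    case False
    have fin: "finite (?W - X x)" using Suc.prems(1) by simp
    from a False fin obtain z where z: "a = Some z" "z \<in> ?W" "z \<notin> X x"
      by (auto simp: answer_def)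
    have "computes H (gather n x s (insert z A) k) (X(x := X x \<union> {z})) f (n + B)"
    proof (rule Suc.IH)
      have "?W - insert z A = (?W - A) - {z}" "z \<in> ?W - A" using z Suc.prems(4) by auto
      then show "card (?W - insert z A) \<le> n" using Suc.prems(1,2) by simp
      show "insert z A \<subseteq> ?W" using Suc.prems(3) z by simp
      show "(X(x := X x \<union> {z})) x \<inter> ?W = insert z A" using Suc.prems(4) z by auto
      have eq: "(X(x := X x \<union> {z}))(x := (X(x := X x \<union> {z})) x \<union> ?W) = X(x := X x \<union> ?W)"
        using z by (auto simp: fun_eq_iff)
      show "computes H (k ?W) ((X(x := X x \<union> {z}))(x := (X(x := X x \<union> {z})) x \<union> ?W)) f B"
        unfolding eq by (rule Suc.prems(5))
    qed (rule Suc.prems(1))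
    with z show ?thesis by (simp add: explore_def)
  qed
  then have "computes H (gather (Suc n) x s A k) X f (Suc (n + B))"
    unfolding gather.simps by (rule computes_Query)
  then show ?case by simp
qed

locale probed_graph =
  fixes H :: "'a wbip" and two :: bool and D :: nat
  assumes fin: "finite (left_part H)" "finite (right_part H)"
    and disj: "left_part H \<inter> right_part H = {}"
    and deg1: "card (wnbrs H x 1) \<le> D"
    and deg2: "two \<Longrightarrow> card (wnbrs H x 2) \<le> D"
begin

abbreviation "g \<equiv> gain two H"

lemma finite_wnbrs: "finite (wnbrs H x s)"
  by (rule finite_subset[of _ "left_part H \<union> right_part H"]) (use fin in \<open>auto simp: wnbrs_def\<close>)

lemma wnbrs_disjoint: "s \<noteq> s' \<Longrightarrow> wnbrs H x s \<inter> wnbrs H x s' = {}"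
  using disj by (auto simp: wnbrs_def)

lemma gain_pos: "{z. 0 < g x z} = wnbrs H x 1 \<union> (if two then wnbrs H x 2 else {})"
  by (auto simp: gain_def row_def)

lemma finite_gain: "finite {z. 0 < g x z}"
  using finite_wnbrs by (simp add: gain_pos)

lemma card_gain: "card {z. 0 < g x z} \<le> 2 * D"
  unfolding gain_pos using deg1[of x] deg2[of x] card_Un_le[of "wnbrs H x 1" "wnbrs H x 2"] by auto

text \<open>A node once returned at \<open>x\<close> is never returned there again, so
  \<open>x\<close> must be fresh. The weight classes are disjoint, so listing weight 1 hides no
  neighbour of weight 2.\<close>

lemma computes_probe:
  assumes "X x = {}"
    and k: "\<And>X'. (\<And>y. y \<noteq> x \<Longrightarrow> X' y = X y) \<Longrightarrow> computes H (k (g x)) X' f B"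
  shows "computes H (probe two D x k) X f (2 * D + B)"
proof -
  let ?X = "X(x := X x \<union> wnbrs H x 1)"
  have "computes H (if two then gather D x 2 {} (\<lambda>B. k (row (wnbrs H x 1) B))
      else k (row (wnbrs H x 1) {})) ?X f (D + B)"
  proof (cases two)
    case True
    have "computes H (gather D x 2 {} (\<lambda>B. k (row (wnbrs H x 1) B))) ?X f (D + B)"
    proof (rule computes_gather)
      show "?X x \<inter> wnbrs H x 2 = {}" using assms(1) wnbrs_disjoint[of 1 2 x] by simp
      show "computes H (k (row (wnbrs H x 1) (wnbrs H x 2))) (?X(x := ?X x \<union> wnbrs H x 2)) f B"
        using k[of "?X(x := ?X x \<union> wnbrs H x 2)"] True by (simp add: gain_def)
    qed (use finite_wnbrs deg2[OF True] in auto)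
    with True show ?thesis by simp
  next
    case False
    then show ?thesis using computes_mono[OF k[of ?X], of "D + B"] by (simp add: gain_def)
  qed
  then have "computes H (probe two D x k) X f (D + (D + B))"
    unfolding probe_def
    by (intro computes_gather) (use finite_wnbrs deg1 assms(1) in auto)
  then show ?thesis by (simp add: mult_2 add.assoc)
qed

lemma computes_visit:
  assumes "distinct xs" "\<And>x. x \<in> set xs \<Longrightarrow> X x = {}"
    and "\<And>X'. (\<And>y. y \<notin> set xs \<Longrightarrow> X' y = X y) \<Longrightarrow>
      computes H (k (\<lambda>x. if x \<in> set xs then g x else c x)) X' f B"
  shows "computes H (visit two D xs c k) X f (2 * D * length xs + B)"
  using assms
proof (induction xs arbitrary: c X)
  case (Cons x xs)
  have "computes H (probe two D x (\<lambda>r. visit two D xs (c(x := r)) k)) X f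
    (2 * D + (2 * D * length xs + B))"
  proof (rule computes_probe)
    show "X x = {}" using Cons.prems(2) by simp
    fix X' assume X': "\<And>y. y \<noteq> x \<Longrightarrow> X' y = X y"
    show "computes H (visit two D xs (c(x := g x)) k) X' f (2 * D * length xs + B)"
    proof (rule Cons.IH)
      show "X' y = {}" if "y \<in> set xs" for y
        using X'[of y] Cons.prems(1,2) that by auto
      fix X'' assume X'': "\<And>y. y \<notin> set xs \<Longrightarrow> X'' y = X' y"
      have "computes H (k (\<lambda>y. if y \<in> set (x # xs) then g y else c y)) X'' f B"
        by (rule Cons.prems(3)) (use X' X'' in simp)
      moreover have "(\<lambda>y. if y \<in> set (x # xs) then g y else c y)
          = (\<lambda>y. if y \<in> set xs then g y else (c(x := g x)) y)" by auto
      ultimately show "computes H (k (\<lambda>y. if y \<in> set xs then g y else (c(x := g x)) y)) X'' f B"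
        by simp
    qed (use Cons.prems(1) in simp)
  qed
  then show ?case by (simp add: algebra_simps)
qed simp

text \<open>Every node of the ball outside \<open>E\<close> is visited exactly once, at
  \<open>2 * D\<close> queries; frontiers avoid visited nodes and are therefore fresh.\<close>

lemma computes_scan:
  assumes "finite E" "finite F" "E \<inter> F = {}" "\<And>x. x \<notin> E \<Longrightarrow> X x = {}"
    and k: "\<And>X'. computes H (k (mask g ((grow g ^^ r) (E \<union> F)))) X' f B"
  shows "computes H (scan two D r E F (mask g E) k) X f
    (2 * D * card ((grow g ^^ r) (E \<union> F) - E) + B)"
  using assms
proof (induction r arbitrary: E F X)
  \<comment> \<open>The outermost layer is visited too, since \<open>auction_local\<close> needs the
    rows on the whole closed ball.\<close>
  case 0
  have mask: "(\<lambda>x. if x \<in> set (list_of F) then g x else mask g E x) = mask g (E \<union> F)"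
    using list_of[OF 0(2)] by (auto simp: mask_def)
  have "computes H (visit two D (list_of F) (mask g E) k) X f (2 * D * length (list_of F) + B)"
  proof (rule computes_visit)
    show "X x = {}" if "x \<in> set (list_of F)" for x
      using that 0(3,4) list_of[OF 0(2)] by auto
    show "computes H (k (\<lambda>x. if x \<in> set (list_of F) then g x else mask g E x)) X' f B" for X'
      unfolding mask using 0(5) by simp
  qed (use list_of[OF 0(2)] in simp)
  moreover have "length (list_of F) = card (E \<union> F - E)"
    using list_of[OF 0(2)] distinct_card[of "list_of F"] 0(3)
    by (simp add: Un_Diff Diff_triv Int_commute)
  ultimately show ?case by simp
next
  case (Suc r)
  let ?E = "E \<union> F" and ?F = "grow g (E \<union> F) - (E \<union> F)"
  have mask: "(\<lambda>x. if x \<in> set (list_of F) then g x else mask g E x) = mask g ?E"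
    using list_of[OF Suc.prems(2)] by (auto simp: mask_def)
  \<comment> \<open>All rows of \<open>?E\<close> are recorded by now, so the frontier computed from
    them is the true one.\<close>
  have frontier: "grow (mask g ?E) ?E = grow g ?E"
    by (auto simp: grow_def mask_def)
  have EF: "?E \<union> ?F = grow g ?E" using subset_grow[of ?E g] by blast
  have fin: "finite (grow g ?E)"
    using finite_funpow_grow[of ?E g 1] Suc.prems(1,2) finite_gain by simp
  have pow: "(grow g ^^ r) (grow g ?E) = (grow g ^^ Suc r) ?E"
    by (simp only: funpow_Suc_right o_def)
  have "computes H (visit two D (list_of F) (mask g E)
      (\<lambda>c'. scan two D r ?E (grow c' ?E - ?E) c' k)) X f
    (2 * D * length (list_of F) + (2 * D * card ((grow g ^^ Suc r) ?E - ?E) + B))"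
  proof (rule computes_visit)
    show "X x = {}" if "x \<in> set (list_of F)" for x
      using that Suc.prems(3,4) list_of[OF Suc.prems(2)] by auto
    fix X' assume X': "\<And>y. y \<notin> set (list_of F) \<Longrightarrow> X' y = X y"
    have "computes H (scan two D r ?E ?F (mask g ?E) k) X' f
      (2 * D * card ((grow g ^^ r) (?E \<union> ?F) - ?E) + B)"
    proof (rule Suc.IH)
      show "X' x = {}" if "x \<notin> ?E" for x
        using that X'[of x] Suc.prems(4)[of x] list_of[OF Suc.prems(2)] by auto
      show "computes H (k (mask g ((grow g ^^ r) (?E \<union> ?F)))) X'' f B" for X''
        unfolding EF pow by (rule Suc.prems(5))
    qed (use Suc.prems(1,2) fin in auto)
    then show "computes H (scan two D r ?E
        (grow (\<lambda>x. if x \<in> set (list_of F) then g x else mask g E x) ?E - ?E)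
        (\<lambda>x. if x \<in> set (list_of F) then g x else mask g E x) k) X' f
      (2 * D * card ((grow g ^^ Suc r) ?E - ?E) + B)"
      unfolding mask frontier EF pow .
  qed (use list_of[OF Suc.prems(2)] in simp)
  moreover have "length (list_of F) + card ((grow g ^^ Suc r) ?E - ?E) = card ((grow g ^^ Suc r) ?E - E)"
  proof -
    let ?P = "(grow g ^^ Suc r) ?E"
    have P: "?E \<subseteq> ?P" by (rule subset_funpow_grow)
    then have split: "?P - E = F \<union> (?P - ?E)" using Suc.prems(3) by blast
    have "finite ?P"
      by (rule finite_funpow_grow) (use Suc.prems(1,2) finite_gain in auto)
    then have "card (?P - E) = card F + card (?P - ?E)"
      unfolding split using Suc.prems(2) by (intro card_Un_disjoint) auto
    then show ?thesis
      using list_of[OF Suc.prems(2)] distinct_card[of "list_of F"] by simp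
  qed
  ultimately show ?case
    by (simp only: scan.simps add_mult_distrib2[symmetric] add.assoc[symmetric])
qed

end

section \<open>The estimator\<close>

lemma sample_mean_deviation:
  fixes h :: "'a \<Rightarrow> real"
  assumes R: "finite R" "R \<noteq> {}" and h: "\<And>y. y \<in> R \<Longrightarrow> 0 \<le> h y \<and> h y \<le> 2"
    and \<eta>: "0 < \<eta>" and \<delta>: "0 < \<delta>" and k: "0 < k" "2 * ln (2 / \<delta>) / \<eta>\<^sup>2 \<le> real k"
  shows "measure_pmf.prob (Pi_pmf {..<k} x0 (\<lambda>_. pmf_of_set R))
    {ys. \<eta> \<le> \<bar>(\<Sum>i<k. h (ys i)) / k - (\<Sum>y\<in>R. h y) / card R\<bar>} \<le> \<delta>"
proof -
  define P where "P = Pi_pmf {..<k} x0 (\<lambda>_. pmf_of_set R)"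
  have component: "map_pmf (\<lambda>ys. ys i) P = pmf_of_set R" if "i < k" for i
    unfolding P_def using that by (subst Pi_pmf_component) auto
  have distr: "distr (measure_pmf P) borel (\<lambda>ys. h (ys i)) = distr (measure_pmf (pmf_of_set R)) borel h"
    if "i < k" for i
  proof -
    have "distr (measure_pmf P) borel (\<lambda>ys. h (ys i))
        = distr (measure_pmf (map_pmf (\<lambda>ys. ys i) P)) borel h"
      unfolding map_pmf_rep_eq by (subst distr_distr) (auto simp: o_def)
    then show ?thesis by (simp add: component[OF that])
  qed
  interpret Hoeffding_ineq_iid "measure_pmf P" "{..<k}" "\<lambda>i ys. h (ys i)" "\<lambda>ys. h (ys 0)" 0 2
    "(\<Sum>y\<in>R. h y) / card R"
  proof unfold_locales
    show "prob_space.indep_vars (measure_pmf P) (\<lambda>_. borel) (\<lambda>i ys. h (ys i)) {..<k}"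
      unfolding P_def
      by (intro prob_space.indep_vars_compose2[OF _ indep_vars_Pi_pmf])
         (auto simp: measure_pmf.prob_space_axioms)
    show "distr (measure_pmf P) borel (\<lambda>ys. h (ys i)) = distr (measure_pmf P) borel (\<lambda>ys. h (ys 0))"
      if "i \<in> {..<k}" for i
      using that distr[of i] distr[of 0] k(1) by simp
    have "ys 0 \<in> R" if "ys \<in> set_pmf P" for ys
    proof -
      have "ys 0 \<in> set_pmf (map_pmf (\<lambda>ys. ys 0) P)" using that by simp
      then show ?thesis using component[OF k(1)] R by simp
    qed
    then show "AE ys in measure_pmf P. h (ys 0) \<in> {0..2}"
      using h by (auto intro!: AE_pmfI)
    have "measure_pmf.expectation P (\<lambda>ys. h (ys 0))
        = measure_pmf.expectation (map_pmf (\<lambda>ys. ys 0) P) h" by simp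
    then show "(\<Sum>y\<in>R. h y) / card R \<equiv> measure_pmf.expectation P (\<lambda>ys. h (ys 0))"
      using R by (simp add: component[OF k(1)] integral_pmf_of_set)
  qed auto
  \<comment> \<open>For values in an interval of length 2 the Hoeffding bound is
    \<open>2 * exp (- k * \<eta>\<^sup>2 / 2)\<close>; the lower bound on \<open>k\<close> makes it
    at most \<open>\<delta>\<close>.\<close>
  have "2 * exp (- 2 * real k * \<eta>\<^sup>2 / (2 - 0)\<^sup>2) \<le> \<delta>"
  proof -
    have "ln (2 / \<delta>) \<le> real k * \<eta>\<^sup>2 / 2"
      using k(2) \<eta> by (simp add: field_simps)
    then have "exp (- (real k * \<eta>\<^sup>2 / 2)) \<le> exp (- ln (2 / \<delta>))" by simp
    also have "\<dots> = \<delta> / 2" using \<delta> by (simp add: exp_minus)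
    finally show ?thesis by (simp add: power2_eq_square mult_ac)
  qed
  moreover have "measure_pmf.prob P
      {ys. \<eta> \<le> \<bar>(\<Sum>i<k. h (ys i)) / k - (\<Sum>y\<in>R. h y) / card R\<bar>}
    \<le> 2 * exp (- 2 * real k * \<eta>\<^sup>2 / (2 - 0)\<^sup>2)"
    using Hoeffding_ineq_abs_ge'[of \<eta>] \<eta> k(1) by (simp add: lessThan_empty_iff)
  ultimately show ?thesis unfolding P_def by linarith
qed

section \<open>The gain graph of a weighted bipartite graph, and the algorithm\<close>

lemma mem_wnbrs_sym: "y \<in> wnbrs H x s \<longleftrightarrow> x \<in> wnbrs H y s"
  by (auto simp: wnbrs_def)

lemma gain_cases:
  obtains "gain two H x y = 2" "y \<in> wnbrs H x 1"
  | "gain two H x y = 1" "two" "y \<in> wnbrs H x 2" "y \<notin> wnbrs H x 1"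
  | "gain two H x y = 0" "y \<notin> wnbrs H x 1" "two \<Longrightarrow> y \<notin> wnbrs H x 2"
  unfolding gain_def row_def by (metis empty_iff)

lemma (in probed_graph) gain_graph: "gain_graph (left_part H) (right_part H) g"
proof
  fix x y
  show "(x \<in> left_part H \<and> y \<in> right_part H) \<or> (x \<in> right_part H \<and> y \<in> left_part H)"
    if "0 < g x y"
    using that by (cases rule: gain_cases[of two H x y]) (auto simp: wnbrs_def)
  show "g x y = g y x"
    using mem_wnbrs_sym[of _ H] by (simp add: gain_def row_def)
  show "g x y \<le> 2" "0 \<le> g x y" by (simp_all add: gain_def row_def)
qed (use fin disj in auto)

text \<open>Few nodes are active only on average over the rounds, so all rounds are averaged instead
  of searching for a good one.\<close>

definition mean_value ::
  "'a set \<Rightarrow> real \<Rightarrow> nat \<Rightarrow> ('a \<Rightarrow> 'a \<Rightarrow> real) \<Rightarrow> 'a \<Rightarrow> real" where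
  "mean_value L \<eta> T g y = (\<Sum>t<T. owned_value L \<eta> g t y) / T"

text \<open>An upper estimate of the curvature needs a lower bound on the transport cost:
  \<open>2 * \<eta> * m\<close> is the auction error in \<open>emd_bounds\<close>, and another
  \<open>\<eta> * m\<close> covers the sampling error.\<close>

definition curvature_guess ::
  "bool \<Rightarrow> real \<Rightarrow> nat \<Rightarrow> nat \<Rightarrow> real \<Rightarrow> real" where
  "curvature_guess two \<eta> m n a =
    1 - ((if two then 3 else 2) * m - m * a - 3 * \<eta> * m) / (1 + real n)"

text \<open>The balls around all samples are explored in one scan: where they overlap, a second
  exploration would not be shown the same neighbours again. Empty \<open>R\<close> is separated
  since it has no uniform distribution.\<close>

definition curvature_alg ::
  "bool \<Rightarrow> nat \<Rightarrow> real \<Rightarrow> nat \<Rightarrow> nat \<Rightarrow> 'a \<Rightarrow> 'a \<Rightarrow> 'a list \<Rightarrow> 'a list \<Rightarrow> 'a query_alg"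
where
  "curvature_alg two D \<eta> T k u v us vs =
    (let L = set us - (set vs \<union> {v}); R = set vs - (set us \<union> {u}) in
     if R = {} then Output 1
     else Choose (map_pmf
       (\<lambda>ys. scan two D (2 * T) {} (ys ` {..<k}) (\<lambda>_ _. 0)
         (\<lambda>c. Output (curvature_guess two \<eta> (card R) (length us)
           ((\<Sum>i<k. mean_value L \<eta> T c (ys i)) / k))))
       (Pi_pmf {..<k} u (\<lambda>_. pmf_of_set R))))"

text \<open>The ball of radius \<open>2 * T\<close> contains the balls of radius
  \<open>2 * t\<close> that \<open>owned_value_local\<close> needs for the rounds
  \<open>t < T\<close>.\<close>

lemma mean_value_mask:
  assumes "y \<in> A"
  shows "mean_value L \<eta> T (mask g ((grow g ^^ (2 * T)) A)) y = mean_value L \<eta> T g y"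
proof -
  have "owned_value L \<eta> g t y = owned_value L \<eta> (mask g ((grow g ^^ (2 * T)) A)) t y" if "t < T" for t
  proof (rule owned_value_local[OF _ assms])
    have "2 * T = (2 * T - 2 * t) + 2 * t" using that by simp
    then have "(grow g ^^ (2 * T)) A = (grow g ^^ (2 * T - 2 * t)) ((grow g ^^ (2 * t)) A)"
      by (metis comp_apply funpow_add)
    then have "(grow g ^^ (2 * t)) A \<subseteq> (grow g ^^ (2 * T)) A"
      using subset_funpow_grow by metis
    then show "g x = mask g ((grow g ^^ (2 * T)) A) x" if "x \<in> (grow g ^^ (2 * t)) A" for x
      using that by (auto simp: mask_def)
  qed
  then show ?thesis by (simp add: mean_value_def)
qed

text \<open>The gain graph has degree at most \<open>2 * D\<close>. With this degree in
  \<open>sum_active_le\<close>, the condition on \<open>T\<close> leaves on average at most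
  \<open>\<eta> * m / 2\<close> active nodes per round.\<close>

locale probed_edge = graph_edge G u v + probed_graph "edge_bip G u v" two D
  for G :: "'a pair_pre_digraph" and u v two D +
  fixes \<eta> :: real and T :: nat
  assumes \<eta>: "0 < \<eta>" and T: "0 < T" "4 * D * (2 + \<eta>) \<le> \<eta>\<^sup>2 * T"
begin

section \<open>Error and query analysis at an edge\<close>

abbreviation "H \<equiv> edge_bip G u v"
abbreviation "m \<equiv> real (card R)"
abbreviation "N \<equiv> 1 + real (deg G u)"
abbreviation "\<kappa> \<equiv> if two then 3 else 2 :: real"

sublocale gain_auction L R g \<eta>
  using gain_graph \<eta> by (simp add: gain_auction_def gain_auction_axioms_def)

text \<open>In case (b) the gain is 3 minus the distance, so both bounds are equalities. In case (a)
  distances 2 and 3 both have gain 0, so the bounds differ by 1; this causes the additive loss of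
  1.\<close>

lemma gdist_gain:
  assumes "x \<in> L" "y \<in> R"
  shows "real (gdist G x y) \<le> 3 - g x y" and "\<kappa> - g x y \<le> real (gdist G x y)"
proof -
  have "x \<notin> R" using assms parts_disjoint by auto
  then have w: "y \<in> wnbrs H x s \<longleftrightarrow> gdist G x y = s" for s
    using assms by (auto simp: wnbrs_def edge_bip_def)
  have "0 < gdist G x y" "gdist G x y \<le> 3"
    using gdist_pos gdist_le_3 assms by auto
  then show "real (gdist G x y) \<le> 3 - g x y" "\<kappa> - g x y \<le> real (gdist G x y)"
    by (cases rule: gain_cases[of two H x y]; auto simp: w)+
qed

lemma emd_bounds:
  defines "S \<equiv> \<Sum>y\<in>R. mean_value L \<eta> T g y"
  shows "N * emd G u v \<le> 3 * m - S" and "\<kappa> * m - S - 2 * \<eta> * m \<le> N * emd G u v"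
proof -
  let ?P = "\<lambda>t. \<Sum>y\<in>R. owned_value L \<eta> g t y"
  \<comment> \<open>In each round the ownership relation is a matching.\<close>
  have upper: "?P t \<le> 3 * m - N * emd G u v" for t
  proof -
    have "N * emd G u v \<le> 3 * m - (\<Sum>y\<in>R. case owner t y of None \<Rightarrow> 0 | Some x \<Rightarrow> owned_value L \<eta> g t y)"
    proof (rule emd_le_matching)
      show "x \<in> L \<and> y \<in> R" if "owner t y = Some x" for x y using owner_adj[OF that] by simp
      show "y = z" if "owner t y = Some x" "owner t z = Some x" for x y z
        using owner_inj[OF that] .
      show "real (gdist G x y) \<le> 3 - owned_value L \<eta> g t y" if "owner t y = Some x" for x y
        using gdist_gain(1)[of x y] owner_adj[OF that] that sym[of x y] by (simp add: owned_value_def)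
    qed
    also have "(\<Sum>y\<in>R. case owner t y of None \<Rightarrow> 0 | Some x \<Rightarrow> owned_value L \<eta> g t y) = ?P t"
      by (rule sum.cong) (auto simp: owned_value_def split: option.split)
    finally show ?thesis by simp
  qed
  \<comment> \<open>In each round \<open>\<kappa> - profit\<close> on \<open>L\<close> and
    \<open>- price\<close> on \<open>R\<close> are feasible potentials, by
    \<open>dual_feasible\<close> and \<open>gdist_gain\<close>.\<close>
  have lower: "\<kappa> * m - N * emd G u v - \<eta> * m - 2 * real (card (active t)) \<le> ?P t" for t
  proof -
    have "(\<Sum>x\<in>L. \<kappa> - profit t x) + (\<Sum>y\<in>R. - price t y) \<le> N * emd G u v"
    proof (rule emd_ge_dual)
      fix x y assume xy: "x \<in> L" "y \<in> R"
      show "\<kappa> - profit t x + - price t y \<le> real (gdist G x y)"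
        using dual_feasible[OF xy(1), of y t] gdist_gain(2)[OF xy] by linarith
    qed
    then have "\<kappa> * m - ((\<Sum>x\<in>L. profit t x) + (\<Sum>y\<in>R. price t y)) \<le> N * emd G u v"
      by (simp add: sum_subtractf sum_negf card_parts mult.commute)
    with dual_le_primal[of t] show ?thesis by linarith
  qed
  have TS: "T * S = (\<Sum>t<T. ?P t)"
    unfolding S_def mean_value_def using T(1)
    by (simp add: sum_divide_distrib[symmetric] sum.swap[of _ R])
  have "T * S \<le> T * (3 * m - N * emd G u v)"
    unfolding TS using sum_bounded_above[of "{..<T}" ?P "3 * m - N * emd G u v"] upper by simp
  then show "N * emd G u v \<le> 3 * m - S" using T(1) by simp
  have act: "2 * (\<Sum>t<T. real (card (active t))) \<le> T * (\<eta> * m)"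
  proof -
    have "\<eta> * (2 * (\<Sum>t<T. real (card (active t)))) \<le> 2 * (real (2 * D) * ((2 + \<eta>) * m))"
      using sum_active_le[of "2 * D" T] card_gain by simp
    also have "\<dots> = (4 * real D * (2 + \<eta>)) * m" by simp
    also have "\<dots> \<le> (\<eta>\<^sup>2 * T) * m" using T(2) by (intro mult_right_mono) simp_all
    also have "\<dots> = \<eta> * (T * (\<eta> * m))" by (simp add: power2_eq_square)
    finally show ?thesis using \<eta> by (simp only: mult_le_cancel_left_pos)
  qed
  have "T * (\<kappa> * m - N * emd G u v - \<eta> * m) - 2 * (\<Sum>t<T. real (card (active t)))
    = (\<Sum>t<T. \<kappa> * m - N * emd G u v - \<eta> * m - 2 * real (card (active t)))"
    by (simp add: sum_subtractf sum_distrib_left)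
  also have "\<dots> \<le> T * S" unfolding TS by (intro sum_mono lower)
  finally have "T * (\<kappa> * m - N * emd G u v - \<eta> * m) - T * (\<eta> * m) \<le> T * S" using act by linarith
  then have "T * (\<kappa> * m - N * emd G u v - \<eta> * m - \<eta> * m) \<le> T * S"
    by (simp only: right_diff_distrib)
  then have "\<kappa> * m - N * emd G u v - \<eta> * m - \<eta> * m \<le> S" using T(1) by simp
  then show "\<kappa> * m - S - 2 * \<eta> * m \<le> N * emd G u v" by simp
qed

lemma additive_approx_curvature_guess:
  assumes close: "\<bar>a - (\<Sum>y\<in>R. mean_value L \<eta> T g y) / m\<bar> \<le> \<eta>" and "R \<noteq> {}"
  shows "additive_approx (3 - \<kappa> + 4 * \<eta>) (curvature G u v)
    (curvature_guess two \<eta> (card R) (deg G u) a)"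
proof -
  define S where "S = (\<Sum>y\<in>R. mean_value L \<eta> T g y)"
  define E where "E = emd G u v"
  have m: "0 < m" "m \<le> N" using assms(2) finite_parts(5) card_R_le by (simp_all add: card_gt_0_iff)
  have "m * a - S = m * (a - S / m)" using m(1) by (simp add: right_diff_distrib)
  then have "\<bar>m * a - S\<bar> = m * \<bar>a - S / m\<bar>" by (simp add: abs_mult)
  also have "\<dots> \<le> m * \<eta>" using close m(1) by (simp add: S_def)
  finally have "\<bar>m * a - S\<bar> \<le> m * \<eta>" .
  then have a: "S - \<eta> * m \<le> m * a" "m * a \<le> S + \<eta> * m" by (simp_all add: mult.commute abs_le_iff)
  have N: "0 < N" by simp
  define Z where "Z = \<kappa> * m - m * a - 3 * \<eta> * m"
  have "Z \<le> N * E" using emd_bounds(2) a(1) unfolding Z_def S_def E_def by linarith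
  then have "Z / N \<le> E" using N by (simp add: pos_divide_le_eq mult.commute)
  \<comment> \<open>The downward shift \<open>3 * \<eta> * m\<close> and the sampling error
    \<open>\<eta> * m\<close> add up to \<open>4 * \<eta> * m\<close>; then \<open>m \<le> N\<close>
    removes the factor \<open>m / N\<close>.\<close>
  moreover have "E \<le> Z / N + (3 - \<kappa> + 4 * \<eta>)"
  proof -
    have "N * E \<le> 3 * m - S" using emd_bounds(1) unfolding S_def E_def .
    also have "\<dots> \<le> Z + (3 * m - \<kappa> * m + 4 * \<eta> * m)" using a(2) unfolding Z_def by linarith
    also have "\<dots> = Z + (3 - \<kappa> + 4 * \<eta>) * m" by (simp add: algebra_simps)
    also have "\<dots> \<le> Z + (3 - \<kappa> + 4 * \<eta>) * N"
      using m(2) \<eta> by (intro add_left_mono mult_left_mono) auto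
    also have "\<dots> = N * (Z / N + (3 - \<kappa> + 4 * \<eta>))"
    proof -
      have "N * (Z / N) = Z" using N by (metis less_irrefl nonzero_mult_div_cancel_left times_divide_eq_right)
      then show ?thesis
        unfolding distrib_left[of N "Z / N"] by (simp only: mult.commute)
    qed
    finally show ?thesis using N by (simp only: mult_le_cancel_left_pos)
  qed
  ultimately show ?thesis
    unfolding additive_approx_def curvature_def curvature_guess_def Z_def E_def by simp
qed

lemma curvature_eq_1:
  assumes "R = {}"
  shows "curvature G u v = 1"
proof -
  have "N * emd G u v = 0" using emd_bounds assms by (intro antisym) simp_all
  then show ?thesis by (simp add: curvature_def add_nonneg_eq_0_iff)
qed

text \<open>For a fixed sample the output is deterministic: by \<open>mean_value_mask\<close> the
  explored ball yields the true mean values. Only the randomness of the sample remains.\<close>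

lemma run_curvature_alg:
  assumes lists: "distinct us" "set us = nbrs G u" "set vs = nbrs G v" and "R \<noteq> {}" and k: "0 < k"
  shows "computes H (curvature_alg two D \<eta> T k u v us vs) (\<lambda>_. {})
    (map_pmf (\<lambda>ys. curvature_guess two \<eta> (card R) (deg G u)
        ((\<Sum>i<k. mean_value L \<eta> T g (ys i)) / k))
      (Pi_pmf {..<k} u (\<lambda>_. pmf_of_set R)))
    (2 * D * (k * (1 + 2 * D) ^ (2 * T)))"
proof -
  let ?guess = "\<lambda>c ys. curvature_guess two \<eta> (card R) (deg G u)
    ((\<Sum>i<k. mean_value L \<eta> T c (ys i)) / k)"
  let ?P = "Pi_pmf {..<k} u (\<lambda>_. pmf_of_set R)"
  have len: "length us = deg G u" using lists distinct_card by fastforce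
  have alg: "curvature_alg two D \<eta> T k u v us vs = Choose (map_pmf
      (\<lambda>ys. scan two D (2 * T) {} (ys ` {..<k}) (mask g {}) (\<lambda>c. Output (?guess c ys))) ?P)"
    using \<open>R \<noteq> {}\<close> unfolding curvature_alg_def Let_def lists len L_def[symmetric] R_def[symmetric]
    by (simp add: mask_def)
  have "computes H (scan two D (2 * T) {} (ys ` {..<k}) (mask g {}) (\<lambda>c. Output (?guess c ys)))
      (\<lambda>_. {}) (return_pmf (?guess g ys)) (2 * D * (k * (1 + 2 * D) ^ (2 * T)))" for ys
  proof -
    let ?A = "ys ` {..<k}"
    have "computes H (scan two D (2 * T) {} ?A (mask g {}) (\<lambda>c. Output (?guess c ys)))
      (\<lambda>_. {}) (return_pmf (?guess g ys)) (2 * D * card ((grow g ^^ (2 * T)) ({} \<union> ?A) - {}) + 0)"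
    proof (rule computes_scan)
      have "?guess (mask g ((grow g ^^ (2 * T)) ?A)) ys = ?guess g ys"
        by (simp add: mean_value_mask)
      then show "computes H (Output (?guess (mask g ((grow g ^^ (2 * T)) ({} \<union> ?A))) ys)) X'
          (return_pmf (?guess g ys)) 0" for X'
        by (simp add: computes_Output)
    qed auto
    then show ?thesis
    proof (rule computes_mono)
      have "card ((grow g ^^ (2 * T)) ?A) \<le> card ?A * (1 + 2 * D) ^ (2 * T)"
        by (rule card_funpow_grow) (use finite_gain card_gain in auto)
      also have "\<dots> \<le> k * (1 + 2 * D) ^ (2 * T)"
        using card_image_le[of "{..<k}" ys] by (intro mult_right_mono) auto
      finally show "2 * D * card ((grow g ^^ (2 * T)) ({} \<union> ?A) - {}) + 0
          \<le> 2 * D * (k * (1 + 2 * D) ^ (2 * T))"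
        by simp
    qed
  qed
  then show ?thesis unfolding alg map_pmf_def[of "?guess g"] by (intro computes_Choose)
qed

lemma curvature_alg_correct:
  assumes lists: "distinct us" "set us = nbrs G u" "set vs = nbrs G v"
    and \<delta>: "0 < \<delta>" and k: "0 < k" "2 * ln (2 / \<delta>) / \<eta>\<^sup>2 \<le> real k"
    and \<rho>: "3 - \<kappa> + 4 * \<eta> \<le> \<rho>"
  defines "r \<equiv> run H (curvature_alg two D \<eta> T k u v us vs)"
  shows "1 - \<delta> \<le> measure_pmf.prob r {(\<beta>, q). additive_approx \<rho> (curvature G u v) \<beta>}"
    and "(\<integral>\<^sup>+ (\<beta>, q). ennreal (real q) \<partial>measure_pmf r)
      \<le> ennreal (2 * D * (k * (1 + 2 * D) ^ (2 * T)))"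
proof -
  let ?B = "2 * D * (k * (1 + 2 * D) ^ (2 * T))"
  let ?ok = "{\<beta>. additive_approx \<rho> (curvature G u v) \<beta>}"
  have "\<exists>f. computes H (curvature_alg two D \<eta> T k u v us vs) (\<lambda>_. {}) f ?B \<and>
    1 - \<delta> \<le> measure_pmf.prob f ?ok"
  proof (cases "R = {}")
    case True
    then have "curvature_alg two D \<eta> T k u v us vs = Output 1"
      unfolding curvature_alg_def Let_def lists R_def by simp
    moreover have "1 \<in> ?ok"
      using curvature_eq_1[OF True] \<rho> \<eta> by (auto simp: additive_approx_def split: if_splits)
    ultimately show ?thesis
      using computes_mono[OF computes_Output[of H 1 "\<lambda>_. {}"], of ?B] \<delta>
      by (intro exI[of _ "return_pmf 1"]) auto
  next
    case False
    let ?guess = "\<lambda>ys. curvature_guess two \<eta> (card R) (deg G u)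
      ((\<Sum>i<k. mean_value L \<eta> T g (ys i)) / k)"
    let ?P = "Pi_pmf {..<k} u (\<lambda>_. pmf_of_set R)"
    let ?bad = "{ys. \<eta> \<le> \<bar>(\<Sum>i<k. mean_value L \<eta> T g (ys i)) / k - (\<Sum>y\<in>R. mean_value L \<eta> T g y) / m\<bar>}"
    have mean: "0 \<le> mean_value L \<eta> T g y \<and> mean_value L \<eta> T g y \<le> 2" for y
      unfolding mean_value_def using T(1) owned_value_bounds
        sum_bounded_above[of "{..<T}" "\<lambda>t. owned_value L \<eta> g t y" 2]
      by (auto simp: divide_le_eq intro!: divide_nonneg_nonneg sum_nonneg)
    have "measure_pmf.prob ?P ?bad \<le> \<delta>"
      by (rule sample_mean_deviation[OF finite_parts(5) False mean \<eta> \<delta> k])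
    moreover have "measure_pmf.prob ?P (- ?bad) = 1 - measure_pmf.prob ?P ?bad"
      using measure_pmf.prob_compl[of ?bad ?P] by (simp add: Compl_eq_Diff_UNIV)
    moreover have "measure_pmf.prob ?P (- ?bad) \<le> measure_pmf.prob ?P (?guess -` ?ok)"
    proof (rule measure_pmf.finite_measure_mono)
      show "- ?bad \<subseteq> ?guess -` ?ok"
      proof
        fix ys assume "ys \<in> - ?bad"
        then have "additive_approx (3 - \<kappa> + 4 * \<eta>) (curvature G u v) (?guess ys)"
          by (intro additive_approx_curvature_guess False) simp
        with \<rho> show "ys \<in> ?guess -` ?ok" by (simp add: additive_approx_def)
      qed
    qed simp
    ultimately have "1 - \<delta> \<le> measure_pmf.prob (map_pmf ?guess ?P) ?ok" by simp
    with run_curvature_alg[OF lists False k(1)] show ?thesis by blast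
  qed
  then obtain f where f: "map_pmf fst r = f" "\<And>s. s \<in> set_pmf r \<Longrightarrow> snd s \<le> ?B"
      "1 - \<delta> \<le> measure_pmf.prob f ?ok"
    unfolding r_def run_def computes_def by blast
  have ok: "{(\<beta>, q). additive_approx \<rho> (curvature G u v) \<beta>} = fst -` ?ok" by auto
  show "1 - \<delta> \<le> measure_pmf.prob r {(\<beta>, q). additive_approx \<rho> (curvature G u v) \<beta>}"
    unfolding ok measure_map_pmf[symmetric] f(1) by (rule f(3))
  have "(\<integral>\<^sup>+ (\<beta>, q). ennreal (real q) \<partial>measure_pmf r) \<le> (\<integral>\<^sup>+ _. ennreal (real ?B) \<partial>measure_pmf r)"
  proof (intro nn_integral_mono_AE AE_pmfI)
    fix s assume "s \<in> set_pmf r"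
    from f(2)[OF this] have "real (snd s) \<le> real ?B" by (simp only: of_nat_le_iff)
    then show "(case s of (\<beta>, q) \<Rightarrow> ennreal (real q)) \<le> ennreal (real ?B)"
      unfolding case_prod_beta by (rule ennreal_leI)
  qed
  then show "(\<integral>\<^sup>+ (\<beta>, q). ennreal (real q) \<partial>measure_pmf r) \<le> ennreal ?B"
    by simp
qed

end

section \<open>Choice of the parameters\<close>

lemma estimates_curvature_alg:
  fixes d \<eta> \<delta> \<rho> :: real
  assumes "0 < \<eta>" "0 < T" "4 * real (nat \<lceil>d\<rceil>) * (2 + \<eta>) \<le> \<eta>\<^sup>2 * T"
    and "0 < \<delta>" "0 < k" "2 * ln (2 / \<delta>) / \<eta>\<^sup>2 \<le> real k"
    and "3 - (if two then 3 else 2) + 4 * \<eta> \<le> \<rho>"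
  shows "estimates_curvature (curvature_alg two (nat \<lceil>d\<rceil>) \<eta> T k)
    (\<lambda>H. max_wdeg_le H 1 d \<and> (two \<longrightarrow> max_wdeg_le H 2 d)) \<rho> \<delta>
    (2 * nat \<lceil>d\<rceil> * (k * (1 + 2 * nat \<lceil>d\<rceil>) ^ (2 * T)))"
  unfolding estimates_curvature_def
proof (intro allI impI, elim conjE, goal_cases)
  case (1 G u v us vs)
  interpret graph_edge G u v
    using 1 by (simp add: graph_edge_def graph_edge_axioms_def)
  \<comment> \<open>The degree bound is required at every \<open>x\<close>; nodes outside both parts
    have no neighbours at all.\<close>
  have deg: "card (wnbrs (edge_bip G u v) x s) \<le> nat \<lceil>d\<rceil>" if "max_wdeg_le (edge_bip G u v) s d" for x s
  proof (cases "x \<in> L \<union> R")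
    case True
    with that have "real (card (wnbrs (edge_bip G u v) x s)) \<le> d"
      by (simp add: max_wdeg_le_def wdeg_def)
    then show ?thesis by linarith
  next
    case False
    then have "wnbrs (edge_bip G u v) x s = {}" by (auto simp: wnbrs_def)
    then show ?thesis by simp
  qed
  interpret probed_edge G u v two "nat \<lceil>d\<rceil>" \<eta> T
    by unfold_locales (use finite_parts parts_disjoint deg 1 assms in auto)
  show ?case
    using curvature_alg_correct[of us vs \<delta> k \<rho>] 1 assms by blast
qed

theorem theorem3:
  fixes d \<epsilon> \<delta> :: real
  assumes "d > 0" and "\<epsilon> > 0" and "0 < \<delta>" and "\<delta> < 1"
  shows "\<exists>C :: real.
    (\<exists>A :: 'a \<Rightarrow> 'a \<Rightarrow> 'a list \<Rightarrow> 'a list \<Rightarrow> 'a query_alg.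
       estimates_curvature A (\<lambda>H. max_wdeg_le H 1 d) (1 + \<epsilon>) \<delta> C) \<and>
    (\<exists>A :: 'a \<Rightarrow> 'a \<Rightarrow> 'a list \<Rightarrow> 'a list \<Rightarrow> 'a query_alg.
       estimates_curvature A (\<lambda>H. max_wdeg_le H 1 d \<and> max_wdeg_le H 2 d) (1 / 2 + \<epsilon>) \<delta> C)"
proof -
  \<comment> \<open>The total error is \<open>3 - \<kappa> + 4 * \<eta>\<close>, so this choice
    gives \<open>1 + \<epsilon>\<close> in case (a) and \<open>\<epsilon>\<close> in case
    (b).\<close>
  define \<eta> where "\<eta> = \<epsilon> / 4"
  define D where "D = nat \<lceil>d\<rceil>"
  obtain T where T: "max 1 (4 * D * (2 + \<eta>) / \<eta>\<^sup>2) \<le> real T" using real_arch_simple by blast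
  obtain k where k: "max 1 (2 * ln (2 / \<delta>) / \<eta>\<^sup>2) \<le> real k" using real_arch_simple by blast
  have \<eta>: "0 < \<eta>" "4 * \<eta> = \<epsilon>" using assms by (simp_all add: \<eta>_def)
  have T': "0 < T" "4 * real D * (2 + \<eta>) \<le> \<eta>\<^sup>2 * T"
    using T \<eta>(1) by (auto simp: pos_divide_le_eq mult.commute)
  have k': "0 < k" "2 * ln (2 / \<delta>) / \<eta>\<^sup>2 \<le> real k" using k by auto
  note est = estimates_curvature_alg[OF \<eta>(1) T'[unfolded D_def] assms(3) k']
  have a: "estimates_curvature (curvature_alg False D \<eta> T k :: 'a \<Rightarrow> _) (\<lambda>H. max_wdeg_le H 1 d) (1 + \<epsilon>) \<delta>
      (2 * D * (k * (1 + 2 * D) ^ (2 * T)))"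
    using est[of False "1 + \<epsilon>"] \<eta>(2) by (simp add: D_def)
  have b: "estimates_curvature (curvature_alg True D \<eta> T k :: 'a \<Rightarrow> _)
      (\<lambda>H. max_wdeg_le H 1 d \<and> max_wdeg_le H 2 d) (1 / 2 + \<epsilon>) \<delta>
      (2 * D * (k * (1 + 2 * D) ^ (2 * T)))"
    using est[of True "1 / 2 + \<epsilon>"] \<eta>(2) by (simp add: D_def)
  \<comment> \<open>The query bound is independent of the case, so one \<open>C\<close> serves
    both.\<close>
  from a b show ?thesis by blast
qed

end
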